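(* Let $A$ be a finite subset of $\mathbb{Z}_+=\{0,1,2,\dots\}$ with $0\in A$. The following statements are equivalent: (i) $A+[0,1]$ is a spectral set. (ii) $A$ is a spectral set. In this case, any spectrum of $A+[0,1]$ has the form $\mathbb{Z}+\Lambda_A$, where $\Lambda_A$ is a spectrum for $A$. Moreover, $A+[0,1]$ has only finitely many spectra that contain $0$.
   Context: For $\lambda\in\mathbb{R}$ let $e_\lambda(x)=e^{2\pi i\lambda x}$. A finite Borel measure $\mu$ on $\mathbb{R}$ is spectral with spectrum $\Lambda\subset\mathbb{R}$ if the family $(e_\lambda)_{\lambda\in\Lambda}$ is an orthogonal basis of $L^2(\mu)$. A finite set $A\subset\mathbb{R}$ is spectral with spectrum $\Lambda$ if the atomic measure $\delta_A=\frac{1}{\#A}\sum_{a\in A}\delta_a$ is spectral with spectrum $\Lambda$. A Lebesgue measurable set $\Omega\subset\mathbb{R}$ of positive finite Lebesgue measure is spectral with spectrum $\Lambda$ if Lebesgue measure restricted to $\Omega$ is spectral with spectrum $\Lambda$. Here $A+[0,1]=\{a+t : a\in A,\ t\in[0,1]\}$. *)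

theory Defs
  imports "HOL-Analysis.Analysis"
begin

definition L2_space :: "'a measure \<Rightarrow> ('a \<Rightarrow> complex) set" where
  "L2_space M = {f \<in> borel_measurable M. integrable M (\<lambda>x. (cmod (f x))\<^sup>2)}"

definition inner_L2 :: "'a measure \<Rightarrow> ('a \<Rightarrow> complex) \<Rightarrow> ('a \<Rightarrow> complex) \<Rightarrow> complex" where
  "inner_L2 M f g = (LINT x|M. f x * cnj (g x))"

definition norm_L2 :: "'a measure \<Rightarrow> ('a \<Rightarrow> complex) \<Rightarrow> real" where
  "norm_L2 M f = sqrt (LINT x|M. (cmod (f x))\<^sup>2)"

text \<open>An orthogonal basis of the Hilbert space is a family of nonzero, pairwise orthogonal
  vectors whose finite linear combinations are dense. It is a family and not a set:
  two distinct indices must give orthogonal vectors, so they cannot give vectors that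
  agree almost everywhere.\<close>

definition orthogonal_basis_L2 ::
    "'a measure \<Rightarrow> 'i set \<Rightarrow> ('i \<Rightarrow> 'a \<Rightarrow> complex) \<Rightarrow> bool" where
  "orthogonal_basis_L2 M I u \<longleftrightarrow>
     (\<forall>i\<in>I. u i \<in> L2_space M \<and> norm_L2 M (u i) \<noteq> 0) \<and>
     (\<forall>i\<in>I. \<forall>j\<in>I. i \<noteq> j \<longrightarrow> inner_L2 M (u i) (u j) = 0) \<and>
     (\<forall>f\<in>L2_space M. \<forall>\<epsilon>>0. \<exists>F c. finite F \<and> F \<subseteq> I \<and>
        norm_L2 M (\<lambda>x. f x - (\<Sum>i\<in>F. c i * u i x)) < \<epsilon>)"

definition expo :: "real \<Rightarrow> real \<Rightarrow> complex" where
  "expo l x = exp (2 * of_real pi * \<i> * of_real l * of_real x)"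

definition spectrum_of_measure :: "real measure \<Rightarrow> real set \<Rightarrow> bool" where
  "spectrum_of_measure M \<Lambda> \<longleftrightarrow>
     sets M = sets borel \<and> finite_measure M \<and> orthogonal_basis_L2 M \<Lambda> expo"

definition uniform_atomic :: "real set \<Rightarrow> real measure" where
  "uniform_atomic A = distr (uniform_count_measure A) borel (\<lambda>x. x)"

lemma emeasure_uniform_atomic:
  assumes "finite A" "A \<noteq> {}" "B \<in> sets borel"
  shows "emeasure (uniform_atomic A) B = ennreal (1 / card A * (\<Sum>a\<in>A. indicator B a))"
proof -
  have "emeasure (uniform_atomic A) B = emeasure (uniform_count_measure A) (B \<inter> A)"
    unfolding uniform_atomic_def using assms
    by (subst emeasure_distr) (auto simp: space_uniform_count_measure measurable_def
        sets_uniform_count_measure)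
  also have "\<dots> = ennreal (card (B \<inter> A) / card A)"
    using assms by (subst emeasure_uniform_count_measure) auto
  also have "real (card (B \<inter> A)) = (\<Sum>a\<in>A. indicator B a)"
    using assms by (simp add: sum.If_cases indicator_def Int_commute)
  finally show ?thesis by simp
qed

text \<open>Restricted Lebesgue measure, regarded as a Borel measure on the whole line. This
  makes sense for Lebesgue measurable sets, which need not be Borel.\<close>

definition lebesgue_part :: "real set \<Rightarrow> real measure" where
  "lebesgue_part \<Omega> = distr (lebesgue_on \<Omega>) borel (\<lambda>x. x)"

lemma emeasure_lebesgue_part:
  assumes "\<Omega> \<in> sets lebesgue" "B \<in> sets borel"
  shows "emeasure (lebesgue_part \<Omega>) B = emeasure lebesgue (B \<inter> \<Omega>)"
proof -
  have "(\<lambda>x. x) \<in> measurable (lebesgue_on \<Omega>) borel"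
    by (rule measurable_restrict_space1) (simp add: measurable_completion)
  then have "emeasure (lebesgue_part \<Omega>) B = emeasure (lebesgue_on \<Omega>) (B \<inter> \<Omega>)"
    unfolding lebesgue_part_def using assms
    by (subst emeasure_distr) (auto simp: space_restrict_space)
  also have "\<dots> = emeasure lebesgue (B \<inter> \<Omega>)"
    using assms by (subst emeasure_restrict_space) auto
  finally show ?thesis .
qed

definition spectrum_of_finite_set :: "real set \<Rightarrow> real set \<Rightarrow> bool" where
  "spectrum_of_finite_set A \<Lambda> \<longleftrightarrow>
     finite A \<and> A \<noteq> {} \<and> spectrum_of_measure (uniform_atomic A) \<Lambda>"

definition spectral_finite_set :: "real set \<Rightarrow> bool" where
  "spectral_finite_set A \<longleftrightarrow> (\<exists>\<Lambda>. spectrum_of_finite_set A \<Lambda>)"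

definition spectrum_of_domain :: "real set \<Rightarrow> real set \<Rightarrow> bool" where
  "spectrum_of_domain \<Omega> \<Lambda> \<longleftrightarrow>
     \<Omega> \<in> sets lebesgue \<and> 0 < emeasure lebesgue \<Omega> \<and> emeasure lebesgue \<Omega> < \<infinity> \<and>
     spectrum_of_measure (lebesgue_part \<Omega>) \<Lambda>"

definition spectral_domain :: "real set \<Rightarrow> bool" where
  "spectral_domain \<Omega> \<longleftrightarrow> (\<exists>\<Lambda>. spectrum_of_domain \<Omega> \<Lambda>)"

definition minkowski_sum :: "real set \<Rightarrow> real set \<Rightarrow> real set" where
  "minkowski_sum S T = {s + t | s t. s \<in> S \<and> t \<in> T}"

end

theory Submission
  imports Defs
begin

text \<open>The Fourier transform of the indicator of \<open>A + [0,1]\<close> at \<open>s\<close> is the product of the mask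
  \<open>\<Sum>a\<in>A. e(s a)\<close>, which is 1-periodic in \<open>s\<close>, and of the transform of \<open>[0,1]\<close>, whose zeros are the
  nonzero integers. Translating a frequency of a spectrum \<open>\<Lambda>\<close> by an integer therefore keeps it
  orthogonal to all other frequencies, so completeness forces \<open>\<Lambda> + \<int> = \<Lambda>\<close>, and
  \<open>\<Lambda> \<inter> [0,1)\<close> turns out to be a spectrum of \<open>A\<close>: a function on \<open>A\<close> orthogonal to it extends, constant
  on each cell \<open>[a,a+1)\<close>, to a function orthogonal to all of \<open>\<Lambda>\<close>. Conversely, if \<open>\<Lambda>\<^sub>A\<close> is a spectrum
  of \<open>A\<close>, then for each fixed \<open>t\<close> the vector \<open>(f(a + t))\<close> expands over \<open>\<Lambda>\<^sub>A\<close>, and the coefficients are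
  approximated by trigonometric polynomials in \<open>t\<close>. Finiteness holds since the mask is a polynomial in
  \<open>e(s)\<close> and so has finitely many zeros in \<open>[0,1)\<close>.\<close>

section \<open>Exponentials as characters of the line\<close>

lemma expo_eq_cis: "expo l x = cis (2 * pi * l * x)"
  by (simp add: expo_def cis_conv_exp mult_ac)

lemma expo_add_left: "expo (l + m) x = expo l x * expo m x"
  by (simp add: expo_eq_cis cis_mult algebra_simps)

lemma expo_add_right: "expo l (x + y) = expo l x * expo l y"
  by (simp add: expo_eq_cis cis_mult algebra_simps)

lemma cnj_expo: "cnj (expo l x) = expo (- l) x"
  by (simp add: expo_eq_cis cis_cnj)

lemma expo_mult_cnj: "expo l x * cnj (expo m x) = expo (l - m) x"
  by (simp add: cnj_expo flip: expo_add_left)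

lemma norm_expo [simp]: "cmod (expo l x) = 1"
  by (simp add: expo_eq_cis)

lemma expo_nonzero [simp]: "expo l x \<noteq> 0"
  by (simp add: expo_eq_cis)

lemma expo_0 [simp]: "expo 0 x = 1" "expo l 0 = 1"
  by (simp_all add: expo_eq_cis)

lemma expo_Ints: "l \<in> \<int> \<Longrightarrow> x \<in> \<int> \<Longrightarrow> expo l x = 1"
proof -
  assume "l \<in> \<int>" "x \<in> \<int>"
  then have "l * x \<in> \<int>" by simp
  then show ?thesis
    using cis_multiple_2pi[of "l * x"] by (simp add: expo_eq_cis mult.assoc)
qed

text \<open>Identifies the circle with the reals modulo the integers, so that frequencies can be
  compared modulo integers through points of the circle.\<close>

lemma expo_1_eq_iff: "expo l 1 = expo m 1 \<longleftrightarrow> l - m \<in> \<int>"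
proof
  assume "expo l 1 = expo m 1"
  then obtain k :: int where
    "2 * of_real pi * \<i> * of_real l = 2 * of_real pi * \<i> * of_real m + of_int (2 * k) * pi * \<i>"
    unfolding expo_def exp_eq by auto
  then have "2 * pi * l = 2 * pi * m + 2 * pi * k"
    by (simp add: complex_eq_iff mult_ac)
  then have "2 * pi * (l - m) = 2 * pi * k" by (simp add: algebra_simps)
  then have "l - m = k" by simp
  then show "l - m \<in> \<int>" by simp
next
  assume "l - m \<in> \<int>"
  then have "expo (l - m) 1 = 1" by (simp add: expo_Ints)
  then have "expo (l - m + m) 1 = expo m 1" by (simp only: expo_add_left) simp
  then show "expo l 1 = expo m 1" by simp
qed

text \<open>This is what turns a sum of exponentials over natural numbers into a polynomial in
  \<open>expo l 1\<close>.\<close>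

lemma expo_of_nat: "expo l (real a) = expo l 1 ^ a"
  by (simp add: expo_eq_cis Complex.DeMoivre mult_ac)

lemma continuous_on_expo [continuous_intros]:
  "continuous_on S f \<Longrightarrow> continuous_on S (\<lambda>x. expo l (f x))"
  unfolding expo_def by (intro continuous_intros)

lemma borel_measurable_expo [measurable]: "expo l \<in> borel_measurable borel"
  using continuous_on_expo[of UNIV "\<lambda>x. x" l] by (intro borel_measurable_continuous_onI) simp

lemma borel_measurable_cnj [measurable (raw)]:
  "f \<in> borel_measurable M \<Longrightarrow> (\<lambda>x. cnj (f x)) \<in> borel_measurable M"
  by (rule borel_measurable_continuous_on[where f = cnj]) (auto intro: continuous_intros)

section \<open>Square-integrable functions\<close>

lemma L2_spaceD:
  assumes "f \<in> L2_space M"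
  shows "f \<in> borel_measurable M" "integrable M (\<lambda>x. (cmod (f x))\<^sup>2)"
  using assms by (auto simp: L2_space_def)

text \<open>The triangle inequality together with \<open>2xy \<le> x\<^sup>2 + y\<^sup>2\<close>. It
  stands in for the Minkowski inequality, so that all estimates can be made with squared
  norms.\<close>

lemma norm_add_power2_le: "(cmod (a + b))\<^sup>2 \<le> 2 * (cmod a)\<^sup>2 + 2 * (cmod b)\<^sup>2"
proof -
  have "(cmod (a + b))\<^sup>2 \<le> (cmod a + cmod b)\<^sup>2"
    by (intro power_mono norm_triangle_ineq) auto
  also have "\<dots> \<le> 2 * (cmod a)\<^sup>2 + 2 * (cmod b)\<^sup>2"
    using sum_squares_bound[of "cmod a" "cmod b"] by (simp add: power2_sum)
  finally show ?thesis .
qed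

lemma norm_diff_power2_le: "(cmod (a - b))\<^sup>2 \<le> 2 * (cmod a)\<^sup>2 + 2 * (cmod b)\<^sup>2"
  using norm_add_power2_le[of a "- b"] by simp

lemma L2_space_bounded:
  assumes "f \<in> borel_measurable M" "integrable M (g :: _ \<Rightarrow> real)" "\<And>x. (cmod (f x))\<^sup>2 \<le> g x"
  shows "f \<in> L2_space M"
  using assms unfolding L2_space_def
  by (auto intro!: Bochner_Integration.integrable_bound[OF assms(2)] simp: order_trans[OF _ abs_ge_self])

lemma L2_space_add:
  assumes "f \<in> L2_space M" "g \<in> L2_space M"
  shows "(\<lambda>x. f x + g x) \<in> L2_space M"
  using assms[THEN L2_spaceD(1)] assms[THEN L2_spaceD(2)]
  by (intro L2_space_bounded[where g = "\<lambda>x. 2 * (cmod (f x))\<^sup>2 + 2 * (cmod (g x))\<^sup>2"])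
     (auto intro: norm_add_power2_le)

lemma L2_space_mult_bounded:
  assumes "f \<in> L2_space M" "g \<in> borel_measurable M" "\<And>x. cmod (g x) \<le> C"
  shows "(\<lambda>x. g x * f x) \<in> L2_space M"
  using assms(1)[THEN L2_spaceD(1)] assms(1)[THEN L2_spaceD(2)] assms(2,3)
  by (intro L2_space_bounded[where g = "\<lambda>x. C\<^sup>2 * (cmod (f x))\<^sup>2"])
     (auto simp: norm_mult power_mult_distrib intro!: mult_right_mono power_mono)

lemma L2_space_scale: "f \<in> L2_space M \<Longrightarrow> (\<lambda>x. c * f x) \<in> L2_space M"
  using L2_space_mult_bounded[of f M "\<lambda>_. c" "cmod c"] by simp

lemma L2_space_diff:
  assumes "f \<in> L2_space M" "g \<in> L2_space M"
  shows "(\<lambda>x. f x - g x) \<in> L2_space M"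
  using L2_space_add[OF assms(1) L2_space_scale[OF assms(2), of "-1"]] by simp

lemma L2_space_sum:
  assumes "\<And>i. i \<in> F \<Longrightarrow> f i \<in> L2_space M"
  shows "(\<lambda>x. \<Sum>i\<in>F. f i x) \<in> L2_space M"
proof (cases "finite F")
  case True
  then show ?thesis using assms
  proof (induction F)
    case empty
    then show ?case by (simp add: L2_space_def)
  next
    case (insert i F)
    then show ?case using L2_space_add[of "f i" M "\<lambda>x. \<Sum>i\<in>F. f i x"] by auto
  qed
qed (simp add: L2_space_def)

lemma L2_space_bounded_finite_measure:
  assumes "finite_measure M" "f \<in> borel_measurable M" "\<And>x. cmod (f x) \<le> C"
  shows "f \<in> L2_space M"
proof (rule L2_space_bounded)
  show "integrable M (\<lambda>_. C\<^sup>2)" using assms(1) by (rule finite_measure.integrable_const)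
  show "(cmod (f x))\<^sup>2 \<le> C\<^sup>2" for x using assms(3) by (intro power_mono) auto
qed (use assms in auto)

lemma integrable_inner_L2:
  assumes "f \<in> L2_space M" "g \<in> L2_space M"
  shows "integrable M (\<lambda>x. f x * cnj (g x))"
proof (rule Bochner_Integration.integrable_bound)
  show "integrable M (\<lambda>x. (cmod (f x))\<^sup>2 + (cmod (g x))\<^sup>2)"
    using assms[THEN L2_spaceD(2)] by simp
  show "(\<lambda>x. f x * cnj (g x)) \<in> borel_measurable M"
    using assms[THEN L2_spaceD(1)] by measurable
  show "AE x in M. norm (f x * cnj (g x)) \<le> norm ((cmod (f x))\<^sup>2 + (cmod (g x))\<^sup>2)"
  proof (rule AE_I2)
    fix x
    show "norm (f x * cnj (g x)) \<le> norm ((cmod (f x))\<^sup>2 + (cmod (g x))\<^sup>2)"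
      using sum_squares_bound[of "cmod (f x)" "cmod (g x)"]
        mult_nonneg_nonneg[OF norm_ge_zero norm_ge_zero, of "f x" "g x"]
      unfolding norm_mult complex_mod_cnj real_norm_def by linarith
  qed
qed

lemma norm_L2_nonneg: "0 \<le> norm_L2 M f"
  by (simp add: norm_L2_def)

lemma norm_L2_less:
  "(LINT x|M. (cmod (f x))\<^sup>2) < \<epsilon>\<^sup>2 \<Longrightarrow> 0 < \<epsilon> \<Longrightarrow> norm_L2 M f < \<epsilon>"
  unfolding norm_L2_def by (metis real_sqrt_less_iff real_sqrt_unique less_imp_le)

text \<open>If \<open>f\<close> is orthogonal to every basis vector, it is orthogonal to every
  finite combination \<open>p\<close>, so by Pythagoras no \<open>p\<close> is closer to
  \<open>f\<close> than 0 is. Density then leaves only norm zero.\<close>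

lemma orthogonal_basis_L2_complete:
  assumes basis: "orthogonal_basis_L2 M I u" and f: "f \<in> L2_space M"
    and orth: "\<And>i. i \<in> I \<Longrightarrow> inner_L2 M f (u i) = 0"
  shows "norm_L2 M f = 0"
proof (rule ccontr)
  assume "norm_L2 M f \<noteq> 0"
  then have "norm_L2 M f > 0" using norm_L2_nonneg[of M f] by simp
  \<comment> \<open>Density is used with \<epsilon> equal to the norm of \<open>f\<close>
    itself.\<close>
  then obtain F c where F: "finite F" "F \<subseteq> I"
    and less: "norm_L2 M (\<lambda>x. f x - (\<Sum>i\<in>F. c i * u i x)) < norm_L2 M f"
    using basis f unfolding orthogonal_basis_L2_def by meson
  have u: "u i \<in> L2_space M" if "i \<in> F" for i
    using that F basis by (auto simp: orthogonal_basis_L2_def)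
  define p where "p = (\<lambda>x. \<Sum>i\<in>F. c i * u i x)"
  have p: "p \<in> L2_space M"
    unfolding p_def by (intro L2_space_sum L2_space_scale u)
  have fp: "integrable M (\<lambda>x. f x * cnj (p x))" by (rule integrable_inner_L2[OF f p])
  have "(LINT x|M. f x * cnj (p x)) = (LINT x|M. (\<Sum>i\<in>F. cnj (c i) * (f x * cnj (u i x))))"
    unfolding p_def by (simp add: sum_distrib_left mult_ac)
  also have "\<dots> = (\<Sum>i\<in>F. cnj (c i) * inner_L2 M f (u i))"
    unfolding inner_L2_def
    by (subst Bochner_Integration.integral_sum)
       (auto intro!: sum.cong integrable_inner_L2 f u)
  also have "\<dots> = 0" using orth F by (intro sum.neutral) auto
  finally have zero: "(LINT x|M. f x * cnj (p x)) = 0" .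
  \<comment> \<open>The subtracted cross term integrates to 0. It is put in because the new
    integrand is \<open>|f - p|\<^sup>2\<close> without the nonnegative term
    \<open>|p|\<^sup>2\<close>, hence bounded by it pointwise.\<close>
  have "(LINT x|M. (cmod (f x))\<^sup>2) = (LINT x|M. (cmod (f x))\<^sup>2 - 2 * Re (f x * cnj (p x)))"
    using fp zero f[THEN L2_spaceD(2)] integral_Re[OF fp] integrable_Re[OF fp]
    by (subst Bochner_Integration.integral_diff) (simp_all del: times_complex.sel)
  also have "\<dots> \<le> (LINT x|M. (cmod (f x - p x))\<^sup>2)"
  proof (rule integral_mono)
    show "integrable M (\<lambda>x. (cmod (f x))\<^sup>2 - 2 * Re (f x * cnj (p x)))"
      using fp f[THEN L2_spaceD(2)]
      by (intro Bochner_Integration.integrable_diff integrable_mult_right integrable_Re) auto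
    show "integrable M (\<lambda>x. (cmod (f x - p x))\<^sup>2)"
      using L2_spaceD(2)[OF L2_space_diff[OF f p]] .
    show "(cmod (f x))\<^sup>2 - 2 * Re (f x * cnj (p x)) \<le> (cmod (f x - p x))\<^sup>2" for x
      using sum_power2_ge_zero[of "Re (p x)" "Im (p x)"]
      unfolding cmod_power2 by (simp add: power2_eq_square algebra_simps)
  qed
  finally have "norm_L2 M f \<le> norm_L2 M (\<lambda>x. f x - p x)"
    by (simp add: norm_L2_def)
  with less show False by (simp add: p_def)
qed

section \<open>Restricted Lebesgue measure\<close>

text \<open>For Borel sets the restricted measure becomes a density over \<open>lborel\<close>,
  which gives access to the rules for integrals against densities.\<close>

lemma lebesgue_part_borel:
  assumes [measurable]: "S \<in> sets borel"
  shows "lebesgue_part S = density lborel (\<lambda>x. ennreal (indicator S x))"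
proof (rule measure_eqI)
  show "sets (lebesgue_part S) = sets (density lborel (\<lambda>x. ennreal (indicator S x)))"
    by (simp add: lebesgue_part_def)
  fix B assume "B \<in> sets (lebesgue_part S)"
  then have [measurable]: "B \<in> sets borel" by (simp add: lebesgue_part_def)
  have "emeasure (density lborel (\<lambda>x. ennreal (indicator S x))) B
      = (\<integral>\<^sup>+ x. indicator (B \<inter> S) x \<partial>lborel)"
    by (subst emeasure_density) (auto simp: indicator_def intro!: nn_integral_cong simp del: nn_integral_indicator)
  also have "\<dots> = emeasure lborel (B \<inter> S)"
    by (subst nn_integral_indicator) auto
  also have "\<dots> = emeasure lebesgue (B \<inter> S)"
    by simp
  also have "\<dots> = emeasure (lebesgue_part S) B"
    by (subst emeasure_lebesgue_part) auto
  finally show "emeasure (lebesgue_part S) B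
      = emeasure (density lborel (\<lambda>x. ennreal (indicator S x))) B" ..
qed

lemma sets_lebesgue_part [simp, measurable_cong]: "sets (lebesgue_part S) = sets borel"
  by (simp add: lebesgue_part_def)

lemma space_lebesgue_part [simp]: "space (lebesgue_part S) = UNIV"
  by (simp add: lebesgue_part_def)

lemma borel_measurable_lebesgue_part [simp]: "borel_measurable (lebesgue_part S) = borel_measurable borel"
  by (rule measurable_cong_sets) auto

lemma integrable_lebesgue_part:
  fixes f :: "real \<Rightarrow> 'b :: {banach, second_countable_topology}"
  assumes "S \<in> sets borel" "f \<in> borel_measurable borel"
  shows "integrable (lebesgue_part S) f \<longleftrightarrow> integrable lborel (\<lambda>x. indicator S x *\<^sub>R f x)"
  using assms by (simp add: lebesgue_part_borel integrable_density)

lemma integral_lebesgue_part: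
  fixes f :: "real \<Rightarrow> 'b :: {banach, second_countable_topology}"
  assumes "S \<in> sets borel" "f \<in> borel_measurable borel"
  shows "integral\<^sup>L (lebesgue_part S) f = (LINT x|lborel. indicator S x *\<^sub>R f x)"
  using assms by (simp add: lebesgue_part_borel integral_density)

lemma AE_lebesgue_part:
  assumes "S \<in> sets borel" and [measurable]: "Measurable.pred borel P"
    and "AE x in lborel. x \<in> S \<longrightarrow> P x"
  shows "AE x in lebesgue_part S. P x"
proof -
  have [measurable]: "S \<in> sets borel" by fact
  show ?thesis
    using assms(3) unfolding lebesgue_part_borel[OF assms(1)]
    by (subst AE_density) (auto simp: indicator_def elim: eventually_mono)
qed

lemma finite_measure_lebesgue_part:
  assumes "S \<in> sets lebesgue" "emeasure lebesgue S < \<infinity>"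
  shows "finite_measure (lebesgue_part S)"
  using assms by (intro finite_measureI) (simp add: emeasure_lebesgue_part)

abbreviation "unit_lebesgue \<equiv> lebesgue_part {0..1}"

lemma finite_measure_unit: "finite_measure unit_lebesgue"
  by (intro finite_measure_lebesgue_part) auto

lemma measure_unit: "measure unit_lebesgue UNIV = 1"
  by (simp add: measure_def emeasure_lebesgue_part)

text \<open>For nonzero \<open>s\<close> the integral is \<open>(expo s 1 - 1) / (2 pi i s)\<close>,
  which vanishes exactly when \<open>expo s 1 = 1\<close>; for \<open>s = 0\<close> it is 1.\<close>

lemma integral_expo_unit:
  "(LINT t|unit_lebesgue. expo s t) = 0 \<longleftrightarrow> s \<in> \<int> \<and> s \<noteq> 0"
proof (cases "s = 0")
  case True
  then show ?thesis by (simp add: measure_unit)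
next
  case False
  define c where "c = 2 * of_real pi * \<i> * complex_of_real s"
  have c: "c \<noteq> 0" using False by (simp add: c_def)
  have e: "expo s t = exp (c * of_real t)" for t by (simp add: expo_def c_def)
  have "(LINT t|unit_lebesgue. expo s t) = (LINT t|lborel. indicator {0..1} t *\<^sub>R expo s t)"
    by (rule integral_lebesgue_part) auto
  also have "\<dots> = exp (c * of_real 1) / c - exp (c * of_real 0) / c"
  proof (rule integral_FTC_Icc)
    fix x
    show "((\<lambda>t. exp (c * of_real t) / c) has_vector_derivative expo s x) (at x within {0..1})"
      unfolding e using c
      by (auto intro!: derivative_eq_intros has_vector_derivative_real_field)
    show "continuous_on {0..1} (expo s)"
      by (rule continuous_on_expo[of _ "\<lambda>x. x", simplified])
  qed auto
  also have "\<dots> = (expo s 1 - 1) / c" by (simp add: e diff_divide_distrib)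
  finally show ?thesis
    using c False expo_1_eq_iff[of s 0] by simp
qed


section \<open>Approximation by linear combinations\<close>

text \<open>The linear span of the family, as a set of functions and not of classes modulo null
  sets.\<close>

definition lin_comb :: "'i set \<Rightarrow> ('i \<Rightarrow> 'a \<Rightarrow> complex) \<Rightarrow> ('a \<Rightarrow> complex) set" where
  "lin_comb I u = {p. \<exists>F c. finite F \<and> F \<subseteq> I \<and> p = (\<lambda>x. \<Sum>i\<in>F. c i * u i x)}"

lemma lin_comb_single: "i \<in> I \<Longrightarrow> (\<lambda>x. c * u i x) \<in> lin_comb I u"
  unfolding lin_comb_def by (intro CollectI exI[of _ "{i}"] exI[of _ "\<lambda>_. c"]) auto

lemma lin_comb_add:
  assumes "p \<in> lin_comb I u" "q \<in> lin_comb I u"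
  shows "(\<lambda>x. p x + q x) \<in> lin_comb I u"
proof -
  obtain F c where F: "finite F" "F \<subseteq> I" "p = (\<lambda>x. \<Sum>i\<in>F. c i * u i x)"
    using assms(1) by (auto simp: lin_comb_def)
  obtain G d where G: "finite G" "G \<subseteq> I" "q = (\<lambda>x. \<Sum>i\<in>G. d i * u i x)"
    using assms(2) by (auto simp: lin_comb_def)
  \<comment> \<open>Both coefficient families are extended by 0 to the union of the index sets, so
    that the sums can be added termwise.\<close>
  let ?c = "\<lambda>i. if i \<in> F then c i else 0" and ?d = "\<lambda>i. if i \<in> G then d i else 0"
  have "p x = (\<Sum>i\<in>F \<union> G. ?c i * u i x)" for x
    unfolding F(3) using F(1) G(1) by (intro sum.mono_neutral_cong_left) auto
  moreover have "q x = (\<Sum>i\<in>F \<union> G. ?d i * u i x)" for x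
    unfolding G(3) using F(1) G(1) by (intro sum.mono_neutral_cong_left) auto
  ultimately have "(\<lambda>x. p x + q x) = (\<lambda>x. \<Sum>i\<in>F \<union> G. (?c i + ?d i) * u i x)"
    by (simp only: sum.distrib distrib_right)
  then show ?thesis
    using F G unfolding lin_comb_def
    by (intro CollectI exI[of _ "F \<union> G"] exI[of _ "\<lambda>i. ?c i + ?d i"]) auto
qed

lemma lin_comb_sum:
  assumes "\<And>j. j \<in> J \<Longrightarrow> p j \<in> lin_comb I u"
  shows "(\<lambda>x. \<Sum>j\<in>J. p j x) \<in> lin_comb I u"
proof -
  have zero: "(\<lambda>x. 0) \<in> lin_comb I u"
    by (simp add: lin_comb_def exI[of _ "{}"])
  show ?thesis
  proof (cases "finite J")
    case True
    then show ?thesis using assms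
    proof (induction J)
      case (insert j J)
      then show ?case using lin_comb_add[of "p j" I u "\<lambda>x. \<Sum>j\<in>J. p j x"] by simp
    qed (simp add: zero)
  qed (simp add: zero)
qed

lemma L2_space_lin_comb:
  assumes "\<And>i. i \<in> I \<Longrightarrow> u i \<in> L2_space M" "p \<in> lin_comb I u"
  shows "p \<in> L2_space M"
  using assms by (auto simp: lin_comb_def intro!: L2_space_sum L2_space_scale)

text \<open>The closure of the span in the square-integrable functions. The squared distance is used
  so that no square roots enter the estimates.\<close>

definition approximable :: "'a measure \<Rightarrow> 'i set \<Rightarrow> ('i \<Rightarrow> 'a \<Rightarrow> complex) \<Rightarrow> ('a \<Rightarrow> complex) set" where
  "approximable M I u = {f \<in> L2_space M.
     \<forall>\<delta>>0. \<exists>p\<in>lin_comb I u. (LINT x|M. (cmod (f x - p x))\<^sup>2) < \<delta>}"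

lemma approximableD:
  assumes "f \<in> approximable M I u"
  shows "f \<in> L2_space M"
    and "\<delta> > 0 \<Longrightarrow> \<exists>p\<in>lin_comb I u. (LINT x|M. (cmod (f x - p x))\<^sup>2) < \<delta>"
  using assms by (auto simp: approximable_def)

lemma orthogonal_basis_L2I:
  assumes "\<And>i. i \<in> I \<Longrightarrow> u i \<in> L2_space M" "\<And>i. i \<in> I \<Longrightarrow> norm_L2 M (u i) \<noteq> 0"
    and "\<And>i j. i \<in> I \<Longrightarrow> j \<in> I \<Longrightarrow> i \<noteq> j \<Longrightarrow> inner_L2 M (u i) (u j) = 0"
    and "L2_space M \<subseteq> approximable M I u"
  shows "orthogonal_basis_L2 M I u"
  unfolding orthogonal_basis_L2_def
proof (intro conjI ballI allI impI)
  fix f and \<epsilon> :: real assume "f \<in> L2_space M" "\<epsilon> > 0"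
  then obtain p where "p \<in> lin_comb I u" "(LINT x|M. (cmod (f x - p x))\<^sup>2) < \<epsilon>\<^sup>2"
    using assms(4) approximableD(2)[of f M I u "\<epsilon>\<^sup>2"] by auto
  moreover from this obtain F c where "finite F" "F \<subseteq> I" "p = (\<lambda>x. \<Sum>i\<in>F. c i * u i x)"
    by (auto simp: lin_comb_def)
  ultimately show "\<exists>F c. finite F \<and> F \<subseteq> I \<and> norm_L2 M (\<lambda>x. f x - (\<Sum>i\<in>F. c i * u i x)) < \<epsilon>"
    using \<open>\<epsilon> > 0\<close> by (intro exI[of _ F] exI[of _ c]) (auto intro: norm_L2_less)
qed (use assms in auto)

lemma integral_norm_add_power2_le:
  assumes "f \<in> L2_space M" "g \<in> L2_space M"
  shows "(LINT x|M. (cmod (f x + g x))\<^sup>2)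
    \<le> 2 * (LINT x|M. (cmod (f x))\<^sup>2) + 2 * (LINT x|M. (cmod (g x))\<^sup>2)"
proof -
  have "(LINT x|M. (cmod (f x + g x))\<^sup>2) \<le> (LINT x|M. 2 * (cmod (f x))\<^sup>2 + 2 * (cmod (g x))\<^sup>2)"
    using assms[THEN L2_spaceD(2)] L2_spaceD(2)[OF L2_space_add[OF assms]]
    by (intro integral_mono norm_add_power2_le) auto
  also have "\<dots> = 2 * (LINT x|M. (cmod (f x))\<^sup>2) + 2 * (LINT x|M. (cmod (g x))\<^sup>2)"
    using assms[THEN L2_spaceD(2)] by simp
  finally show ?thesis .
qed

context
  fixes M :: "'a measure" and I :: "'i set" and u :: "'i \<Rightarrow> 'a \<Rightarrow> complex"
  assumes u: "\<And>i. i \<in> I \<Longrightarrow> u i \<in> L2_space M"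
begin

text \<open>A closure is closed: two errors below \<delta>/4 combine to one below \<delta>, because
  the squared triangle inequality costs a factor 2 on each.\<close>

lemma approximable_close:
  assumes "f \<in> L2_space M"
    and "\<And>\<delta>. \<delta> > 0 \<Longrightarrow> \<exists>g\<in>approximable M I u. (LINT x|M. (cmod (f x - g x))\<^sup>2) < \<delta>"
  shows "f \<in> approximable M I u"
proof -
  have "\<exists>p\<in>lin_comb I u. (LINT x|M. (cmod (f x - p x))\<^sup>2) < \<delta>" if \<delta>: "\<delta> > 0" for \<delta>
  proof -
    have \<delta>4: "\<delta> / 4 > 0" using \<delta> by simp
    obtain g where g: "g \<in> approximable M I u" "(LINT x|M. (cmod (f x - g x))\<^sup>2) < \<delta> / 4"
      using assms(2)[OF \<delta>4] by blast
    obtain p where p: "p \<in> lin_comb I u" "(LINT x|M. (cmod (g x - p x))\<^sup>2) < \<delta> / 4"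
      using approximableD(2)[OF g(1) \<delta>4] by auto
    have "(LINT x|M. (cmod ((f x - g x) + (g x - p x)))\<^sup>2)
       \<le> 2 * (LINT x|M. (cmod (f x - g x))\<^sup>2) + 2 * (LINT x|M. (cmod (g x - p x))\<^sup>2)"
      by (intro integral_norm_add_power2_le L2_space_diff assms(1)
          approximableD(1)[OF g(1)] L2_space_lin_comb[OF u p(1)])
    with g p show ?thesis by (intro bexI[of _ p]) auto
  qed
  with assms(1) show ?thesis by (auto simp: approximable_def)
qed

lemma lin_comb_approximable: "p \<in> lin_comb I u \<Longrightarrow> p \<in> approximable M I u"
proof -
  assume p: "p \<in> lin_comb I u"
  have "(LINT x|M. (cmod (p x - p x))\<^sup>2) < \<delta>" if "\<delta> > 0" for \<delta>
    using that by simp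
  with p L2_space_lin_comb[OF u p] show ?thesis
    unfolding approximable_def by blast
qed

lemma approximable_add:
  assumes "f \<in> approximable M I u" "g \<in> approximable M I u"
  shows "(\<lambda>x. f x + g x) \<in> approximable M I u"
proof -
  have "\<exists>p\<in>lin_comb I u. (LINT x|M. (cmod (f x + g x - p x))\<^sup>2) < \<delta>" if \<delta>: "\<delta> > 0" for \<delta>
  proof -
    have \<delta>4: "\<delta> / 4 > 0" using \<delta> by simp
    obtain p where p: "p \<in> lin_comb I u" "(LINT x|M. (cmod (f x - p x))\<^sup>2) < \<delta> / 4"
      using approximableD(2)[OF assms(1) \<delta>4] by auto
    obtain q where q: "q \<in> lin_comb I u" "(LINT x|M. (cmod (g x - q x))\<^sup>2) < \<delta> / 4"
      using approximableD(2)[OF assms(2) \<delta>4] by auto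
    have "(LINT x|M. (cmod ((f x - p x) + (g x - q x)))\<^sup>2)
       \<le> 2 * (LINT x|M. (cmod (f x - p x))\<^sup>2) + 2 * (LINT x|M. (cmod (g x - q x))\<^sup>2)"
      by (intro integral_norm_add_power2_le L2_space_diff assms[THEN approximableD(1)]
          L2_space_lin_comb[OF u p(1)] L2_space_lin_comb[OF u q(1)])
    with p q show ?thesis
      by (intro bexI[OF _ lin_comb_add[OF p(1) q(1)]]) (simp add: add_diff_add)
  qed
  then show ?thesis
    using L2_space_add[OF assms[THEN approximableD(1)]] by (auto simp: approximable_def)
qed

lemma lin_comb_scale: "p \<in> lin_comb I u \<Longrightarrow> (\<lambda>x. c * p x) \<in> lin_comb I u"
proof -
  assume "p \<in> lin_comb I u"
  then obtain F d where F: "finite F" "F \<subseteq> I" "p = (\<lambda>x. \<Sum>i\<in>F. d i * u i x)"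
    by (auto simp: lin_comb_def)
  then have "(\<lambda>x. c * p x) = (\<lambda>x. \<Sum>i\<in>F. (c * d i) * u i x)"
    by (simp add: sum_distrib_left mult.assoc)
  with F(1,2) show ?thesis
    unfolding lin_comb_def by (intro CollectI exI[of _ F] exI[of _ "\<lambda>i. c * d i"]) auto
qed

lemma approximable_scale:
  assumes "f \<in> approximable M I u"
  shows "(\<lambda>x. c * f x) \<in> approximable M I u"
proof -
  have "\<exists>p\<in>lin_comb I u. (LINT x|M. (cmod (c * f x - p x))\<^sup>2) < \<delta>" if \<delta>: "\<delta> > 0" for \<delta>
  proof -
    \<comment> \<open>Adding 1 keeps the divisor positive when \<open>c = 0\<close>.\<close>
    have pos: "0 < (cmod c)\<^sup>2 + 1" using zero_le_power2[of "cmod c"] by linarith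
    then have \<delta>c: "\<delta> / ((cmod c)\<^sup>2 + 1) > 0" using \<delta> by simp
    obtain p where p: "p \<in> lin_comb I u"
      "(LINT x|M. (cmod (f x - p x))\<^sup>2) < \<delta> / ((cmod c)\<^sup>2 + 1)"
      using approximableD(2)[OF assms \<delta>c] by blast
    have "(LINT x|M. (cmod (c * f x - c * p x))\<^sup>2) = (cmod c)\<^sup>2 * (LINT x|M. (cmod (f x - p x))\<^sup>2)"
      by (simp only: norm_mult power_mult_distrib integral_mult_right_zero flip: right_diff_distrib)
    also have "\<dots> \<le> ((cmod c)\<^sup>2 + 1) * (LINT x|M. (cmod (f x - p x))\<^sup>2)"
      by (intro mult_right_mono) auto
    also have "\<dots> < \<delta>" 
      using p(2) unfolding pos_less_divide_eq[OF pos] by (subst mult.commute)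
    finally show ?thesis
      by (intro bexI[OF _ lin_comb_scale[OF p(1)]])
  qed
  then show ?thesis
    using L2_space_scale[OF approximableD(1)[OF assms]] unfolding approximable_def by blast
qed

lemma approximable_sum:
  assumes "\<And>j. j \<in> J \<Longrightarrow> f j \<in> approximable M I u"
  shows "(\<lambda>x. \<Sum>j\<in>J. f j x) \<in> approximable M I u"
proof -
  have zero: "(\<lambda>x. 0) \<in> approximable M I u"
    using lin_comb_approximable[OF lin_comb_sum[of "{}"]] by simp
  show ?thesis
  proof (cases "finite J")
    case True
    then show ?thesis using assms
    proof (induction J)
      case (insert j J)
      then show ?case using approximable_add[of "f j" "\<lambda>x. \<Sum>j\<in>J. f j x"] by simp
    qed (simp add: zero)
  qed (simp add: zero)
qed

text \<open>By dominated convergence the squared distances from \<open>s n\<close> to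
  \<open>f\<close> tend to 0, so closedness of the approximable functions applies.\<close>

lemma approximable_limit:
  assumes s: "\<And>n. s n \<in> approximable M I u" and f: "f \<in> L2_space M"
    and lim: "AE x in M. (\<lambda>n. s n x) \<longlonglongrightarrow> f x"
    and g: "integrable M g" and bound: "\<And>n. AE x in M. (cmod (f x - s n x))\<^sup>2 \<le> g x"
  shows "f \<in> approximable M I u"
proof (rule approximable_close[OF f])
  have [measurable]: "f \<in> borel_measurable M" "\<And>n. s n \<in> borel_measurable M"
    using f s[THEN approximableD(1)] by (auto simp: L2_space_def)
  have "(\<lambda>n. LINT x|M. (cmod (f x - s n x))\<^sup>2) \<longlonglongrightarrow> (LINT x|M. 0)"
  proof (rule integral_dominated_convergence[where w = g])
    show "AE x in M. (\<lambda>n. (cmod (f x - s n x))\<^sup>2) \<longlonglongrightarrow> 0"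
      using lim
    proof eventually_elim
      case (elim x)
      then have "(\<lambda>n. (cmod (f x - s n x))\<^sup>2) \<longlonglongrightarrow> (cmod (f x - f x))\<^sup>2"
        by (intro tendsto_intros)
      then show ?case by simp
    qed
    show "AE x in M. norm ((cmod (f x - s n x))\<^sup>2) \<le> g x" for n
      using bound[of n] unfolding real_norm_def abs_power2 .
  qed (use g in auto)
  then have "(\<lambda>n. LINT x|M. (cmod (f x - s n x))\<^sup>2) \<longlonglongrightarrow> 0" by simp
  then show "\<exists>g\<in>approximable M I u. (LINT x|M. (cmod (f x - g x))\<^sup>2) < \<delta>" if "\<delta> > 0" for \<delta>
    using order_tendstoD(2)[OF _ that] s eventually_happens'[OF sequentially_bot] by blast
qed

text \<open>A measurable function is a pointwise limit of simple functions \<open>s\<close> with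
  \<open>|s| \<le> 2|f|\<close>. These are finite combinations of indicators, and the bound supplies
  the dominating function.\<close>

lemma L2_space_approximable_if_indicator:
  assumes fin: "finite_measure M"
    and ind: "\<And>B. B \<in> sets M \<Longrightarrow> (\<lambda>x. complex_of_real (indicator B x)) \<in> approximable M I u"
  shows "L2_space M \<subseteq> approximable M I u"
proof
  fix f assume f: "f \<in> L2_space M"
  obtain s where s: "\<And>i. simple_function M (s i)"
      "\<And>x. x \<in> space M \<Longrightarrow> (\<lambda>i. s i x) \<longlonglongrightarrow> f x"
      "\<And>i x. x \<in> space M \<Longrightarrow> dist (s i x) 0 \<le> 2 * dist (f x) 0"
    using borel_measurable_implies_sequence_metric[OF L2_spaceD(1)[OF f], of 0] by metis
  \<comment> \<open>The representation by indicators equals \<open>s n\<close> only on the space of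
    \<open>M\<close>. Working with \<open>g\<close> lets the closure rules apply to a function given
    literally as such a sum.\<close>
  define g where
    "g n x = (\<Sum>y\<in>s n ` space M. y * complex_of_real (indicator (s n -` {y} \<inter> space M) x))" for n x
  have g: "g n x = s n x" if "x \<in> space M" for n x
    using simple_function_indicator_representation_banach[OF s(1) that, of n]
    by (simp only: g_def scaleR_conv_of_real mult.commute)
  show "f \<in> approximable M I u"
  proof (rule approximable_limit[OF _ f])
    show "g n \<in> approximable M I u" for n
      unfolding g_def
      by (intro approximable_sum approximable_scale ind simple_functionD(2)[OF s(1)])
    show "AE x in M. (\<lambda>n. g n x) \<longlonglongrightarrow> f x"
    proof (rule AE_I2)
      fix x assume x: "x \<in> space M"
      show "(\<lambda>n. g n x) \<longlonglongrightarrow> f x"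
        using s(2)[OF x] by (simp add: g[OF x])
    qed
    show "integrable M (\<lambda>x. 2 * (cmod (f x))\<^sup>2 + 2 * (2 * cmod (f x))\<^sup>2)"
      using L2_spaceD(2)[OF f] by (simp add: power_mult_distrib)
    show "AE x in M. (cmod (f x - g n x))\<^sup>2 \<le> 2 * (cmod (f x))\<^sup>2 + 2 * (2 * cmod (f x))\<^sup>2" for n
    proof (rule AE_I2)
      fix x assume x: "x \<in> space M"
      show "(cmod (f x - g n x))\<^sup>2 \<le> 2 * (cmod (f x))\<^sup>2 + 2 * (2 * cmod (f x))\<^sup>2"
        using norm_diff_power2_le[of "f x" "s n x"] power_mono[OF s(3)[OF x, of n], of 2]
        by (simp add: g[OF x])
    qed
  qed
qed

end


section \<open>Density of trigonometric polynomials on the unit interval\<close>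

lemma expo_L2:
  assumes "finite_measure M" "sets M = sets borel"
  shows "expo l \<in> L2_space M"
proof (rule L2_space_bounded_finite_measure[OF assms(1)])
  show "expo l \<in> borel_measurable M"
    using borel_measurable_expo measurable_cong_sets[OF assms(2) refl] by blast
  show "cmod (expo l x) \<le> 1" for x by simp
qed

lemma inner_expo: "inner_L2 M (expo l) (expo m) = (LINT x|M. expo (l - m) x)"
  by (simp add: inner_L2_def expo_mult_cnj)

text \<open>Integers are closed under addition, so the trigonometric polynomials form an
  algebra.\<close>

lemma trig_mult:
  assumes "p \<in> lin_comb \<int> expo" "q \<in> lin_comb \<int> expo"
  shows "(\<lambda>x. p x * q x) \<in> lin_comb \<int> expo"
proof -
  obtain F c where F: "finite F" "F \<subseteq> \<int>" "p = (\<lambda>x. \<Sum>i\<in>F. c i * expo i x)"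
    using assms(1) by (auto simp: lin_comb_def)
  obtain G d where G: "finite G" "G \<subseteq> \<int>" "q = (\<lambda>x. \<Sum>i\<in>G. d i * expo i x)"
    using assms(2) by (auto simp: lin_comb_def)
  have "(\<lambda>x. p x * q x) = (\<lambda>x. \<Sum>i\<in>F. \<Sum>j\<in>G. (c i * d j) * expo (i + j) x)"
    by (simp add: F(3) G(3) sum_product expo_add_left mult_ac)
  also have "\<dots> \<in> lin_comb \<int> expo"
    using F(2) G(2) by (intro lin_comb_sum lin_comb_single Ints_add) auto
  finally show ?thesis .
qed

text \<open>Sums and products stay in the algebra of trigonometric polynomials, so only real-linear
  functions of the plane need a computation.\<close>

lemma real_polynomial_circle_trig:
  assumes "real_polynomial_function (f :: complex \<Rightarrow> real)"
  shows "(\<lambda>t. complex_of_real (f (expo 1 t))) \<in> lin_comb \<int> expo"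
  using assms
proof induction
  case (linear f)
  interpret bounded_linear f by fact
  have eq: "f z = Re z * f 1 + Im z * f \<i>" for z
  proof -
    have "z = Re z *\<^sub>R 1 + Im z *\<^sub>R \<i>" by (rule complex_eqI) simp_all
    then have "f z = f (Re z *\<^sub>R 1 + Im z *\<^sub>R \<i>)" by (rule arg_cong)
    also have "\<dots> = Re z * f 1 + Im z * f \<i>" by (simp only: add scaleR real_scaleR_def)
    finally show ?thesis .
  qed
  \<comment> \<open>On the circle the real and imaginary parts of \<open>z = expo 1 t\<close> are
    combinations of \<open>z\<close> and its conjugate \<open>expo (- 1) t\<close>.\<close>
  have "(\<lambda>t. complex_of_real (f (expo 1 t))) =
      (\<lambda>t. (f 1 - \<i> * f \<i>) / 2 * expo 1 t + (f 1 + \<i> * f \<i>) / 2 * expo (- 1) t)"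
    by (rule ext, subst eq) (simp add: complex_eq_iff field_simps flip: cnj_expo)
  also have "\<dots> \<in> lin_comb \<int> expo"
    by (intro lin_comb_add lin_comb_single) auto
  finally show ?case .
next
  case (const c)
  show ?case using lin_comb_single[of 0 \<int> "complex_of_real c" expo] by simp
next
  case (add f g)
  then show ?case using lin_comb_add by fastforce
next
  case (mult f g)
  then show ?case using trig_mult by fastforce
qed

lemma expo_L2_unit: "expo l \<in> L2_space unit_lebesgue"
  by (intro expo_L2 finite_measure_unit) simp

text \<open>Stone-Weierstrass on the circle, a compact subset of the plane, gives uniform
  approximation by polynomials. The unit interval has measure 1, so uniform error bounds the error
  in square mean.\<close>

lemma continuous_circle_approximable:
  fixes \<phi> :: "complex \<Rightarrow> real"
  assumes "continuous_on (sphere 0 1) \<phi>"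
  shows "(\<lambda>t. complex_of_real (\<phi> (expo 1 t))) \<in> approximable unit_lebesgue \<int> expo"
proof (rule approximable_close[OF expo_L2_unit])
  have cont: "continuous_on UNIV (\<lambda>t. \<phi> (expo 1 t))"
    by (rule continuous_on_compose2[OF assms])
       (auto intro!: continuous_on_expo continuous_on_id)
  have meas: "(\<lambda>t. complex_of_real (\<phi> (expo 1 t))) \<in> borel_measurable borel"
    using cont by (intro borel_measurable_continuous_onI continuous_intros)
  have "bounded (\<phi> ` sphere 0 1)"
    by (intro compact_imp_bounded compact_continuous_image assms compact_sphere)
  then obtain B where "\<forall>x\<in>\<phi> ` sphere 0 1. norm x \<le> B"
    unfolding bounded_iff by blast
  then have "norm (\<phi> (expo 1 t)) \<le> B" for t
    by (elim ballE[where x = "\<phi> (expo 1 t)"]) auto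
  then have B: "cmod (complex_of_real (\<phi> (expo 1 t))) \<le> B" for t
    unfolding norm_of_real real_norm_def .
  show "(\<lambda>t. complex_of_real (\<phi> (expo 1 t))) \<in> L2_space unit_lebesgue"
    by (rule L2_space_bounded_finite_measure[OF finite_measure_unit _ B])
       (unfold borel_measurable_lebesgue_part, rule meas)
  fix \<delta> :: real assume \<delta>: "\<delta> > 0"
  \<comment> \<open>With this uniform error the integrated squared error is at most \<delta>/2,
    strictly below \<delta>.\<close>
  define e where "e = sqrt (\<delta> / 2)"
  have e: "e > 0" "e\<^sup>2 = \<delta> / 2" using \<delta> by (auto simp: e_def)
  obtain q where q: "real_polynomial_function q" "\<And>z. z \<in> sphere 0 1 \<Longrightarrow> \<bar>\<phi> z - q z\<bar> < e"
    using Stone_Weierstrass_real_polynomial_function[OF compact_sphere assms e(1)] by metis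
  let ?q = "\<lambda>t. complex_of_real (q (expo 1 t))"
  have q': "?q \<in> lin_comb \<int> expo"
    by (rule real_polynomial_circle_trig[OF q(1)])
  have qm: "?q \<in> borel_measurable borel"
    using L2_space_lin_comb[OF expo_L2_unit q'] by (auto simp: L2_space_def)
  have bound: "(cmod (complex_of_real (\<phi> (expo 1 t)) - ?q t))\<^sup>2 \<le> \<delta> / 2" for t
  proof -
    have "\<bar>\<phi> (expo 1 t) - q (expo 1 t)\<bar>\<^sup>2 \<le> e\<^sup>2"
      using q(2)[of "expo 1 t"] by (intro power_mono) auto
    then show ?thesis unfolding e(2) of_real_diff[symmetric] norm_of_real .
  qed
  have "(LINT t|unit_lebesgue. (cmod (complex_of_real (\<phi> (expo 1 t)) - ?q t))\<^sup>2)
      \<le> (LINT t|unit_lebesgue. \<delta> / 2)"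
  proof (rule integral_mono[OF _ _ bound])
    show int: "integrable unit_lebesgue (\<lambda>t. \<delta> / 2)"
      by (rule finite_measure.integrable_const[OF finite_measure_unit])
    show "integrable unit_lebesgue (\<lambda>t. (cmod (complex_of_real (\<phi> (expo 1 t)) - ?q t))\<^sup>2)"
      using meas qm bound order_trans[OF bound abs_ge_self]
      by (intro Bochner_Integration.integrable_bound[OF int]) auto
  qed
  also have "\<dots> < \<delta>" using \<delta> by (simp add: measure_unit)
  finally show "\<exists>g\<in>approximable unit_lebesgue \<int> expo.
      (LINT t|unit_lebesgue. (cmod (complex_of_real (\<phi> (expo 1 t)) - g t))\<^sup>2) < \<delta>"
    by (intro bexI[of _ ?q] lin_comb_approximable expo_L2_unit q')
qed

lemma AE_unit_open: "AE t in unit_lebesgue. 0 < t \<and> t < 1"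
proof (rule AE_lebesgue_part)
  have "AE t in lborel. t \<noteq> (0::real)" "AE t in lborel. t \<noteq> (1::real)"
    by (rule AE_lborel_singleton)+
  then show "AE t in lborel. t \<in> {0..1::real} \<longrightarrow> 0 < t \<and> t < 1"
    by eventually_elim auto
qed auto

text \<open>The distance to the image of \<open>{0..1} - G\<close> on the circle detects membership in \<open>G\<close>, even
  at the glued endpoints, so its cut-off multiples are continuous functions on the circle that
  increase to the indicator of \<open>G\<close>.\<close>

lemma open_indicator_approximable:
  assumes "open G" "G \<subseteq> {0<..<1}"
  shows "(\<lambda>t. complex_of_real (indicator G t)) \<in> approximable unit_lebesgue \<int> expo"
proof -
  define C where "C = expo 1 ` ({0..1} - G)"
  have "compact ({0..1} - G)"
    using assms(1) by (intro compact_diff) auto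
  then have "compact C"
    unfolding C_def by (intro compact_continuous_image continuous_on_expo continuous_on_id)
  then have C: "closed C" by (rule compact_imp_closed)
  \<comment> \<open>Nonemptiness of \<open>C\<close> matters because \<open>infdist\<close> to the
    empty set is 0 by convention.\<close>
  have "0 \<in> {0..1} - G" using assms(2) by auto
  then have ne: "C \<noteq> {}" unfolding C_def by blast
  have mem: "expo 1 t \<in> C \<longleftrightarrow> t \<notin> G" if t: "t \<in> {0..1}" for t
  proof
    assume "expo 1 t \<in> C"
    then obtain s where s: "s \<in> {0..1}" "s \<notin> G" "expo 1 t = expo 1 s" by (auto simp: C_def)
    then have "expo t 1 = expo s 1" by (simp add: expo_eq_cis)
    then obtain k :: int where k: "t - s = k" unfolding expo_1_eq_iff by (auto elim: Ints_cases)
    show "t \<notin> G"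
    proof
      assume "t \<in> G"
      then have "0 < t" "t < 1" using assms(2) by auto
      with s k have "real_of_int k > -1" "real_of_int k < 1" by auto
      then have "k = 0" by linarith
      with k s \<open>t \<in> G\<close> show False by simp
    qed
  qed (use t in \<open>auto simp: C_def\<close>)
  define \<phi> where "\<phi> n z = min 1 (real n * infdist z C)" for n z
  have s: "(\<lambda>t. complex_of_real (\<phi> n (expo 1 t))) \<in> approximable unit_lebesgue \<int> expo" for n
    unfolding \<phi>_def
    by (intro continuous_circle_approximable continuous_intros)
  have lim: "(\<lambda>n. \<phi> n (expo 1 t)) \<longlonglongrightarrow> indicator G t" if t: "t \<in> {0..1}" for t
  proof (cases "t \<in> G")
    case False
    then have "expo 1 t \<in> C" using mem[OF t] by simp
    then show ?thesis using False by (simp add: \<phi>_def)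
  next
    case True
    then have "expo 1 t \<notin> C" using mem[OF t] by simp
    then have "infdist (expo 1 t) C > 0"
      using infdist_pos_not_in_closed[OF C ne] by simp
    then obtain m where m: "1 < real m * infdist (expo 1 t) C"
      using reals_Archimedean3 by blast
    have "\<phi> n (expo 1 t) = 1" if "n \<ge> m" for n
    proof -
      have "real m * infdist (expo 1 t) C \<le> real n * infdist (expo 1 t) C"
        using that infdist_nonneg by (intro mult_right_mono) auto
      with m show ?thesis by (simp add: \<phi>_def)
    qed
    then have "\<forall>\<^sub>F n in sequentially. \<phi> n (expo 1 t) = indicator G t"
      using True unfolding eventually_sequentially by (intro exI[of _ m]) simp
    then show ?thesis by (rule tendsto_eventually)
  qed
  have unit: "AE t in unit_lebesgue. t \<in> {0..1}"
    using AE_unit_open by eventually_elim auto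
  have \<phi>01: "0 \<le> \<phi> n z" "\<phi> n z \<le> 1" for n z
    by (auto simp: \<phi>_def infdist_nonneg)
  show ?thesis
  proof (rule approximable_limit[OF expo_L2_unit s])
    have "G \<in> sets borel" using assms(1) by simp
    then show "(\<lambda>t. complex_of_real (indicator G t)) \<in> L2_space unit_lebesgue"
      by (intro L2_space_bounded_finite_measure[OF finite_measure_unit, where C = 1])
         (auto simp: indicator_def)
    show "AE t in unit_lebesgue. (\<lambda>n. complex_of_real (\<phi> n (expo 1 t)))
        \<longlonglongrightarrow> complex_of_real (indicator G t)"
      using unit by eventually_elim (intro tendsto_of_real lim)
    show "integrable unit_lebesgue (\<lambda>_. 1 :: real)"
      by (rule finite_measure.integrable_const[OF finite_measure_unit])
    show "AE t in unit_lebesgue. (cmod (complex_of_real (indicator G t)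
        - complex_of_real (\<phi> n (expo 1 t))))\<^sup>2 \<le> 1" for n
    proof (rule AE_I2)
      fix t
      have "\<bar>indicator G t - \<phi> n (expo 1 t)\<bar> \<le> 1"
        using \<phi>01[of n "expo 1 t"] by (auto simp: indicator_def)
      then show "(cmod (complex_of_real (indicator G t) - complex_of_real (\<phi> n (expo 1 t))))\<^sup>2 \<le> 1"
        unfolding of_real_diff[symmetric] norm_of_real by (intro power_le_one) auto
    qed
  qed
qed

text \<open>It suffices to treat indicators of Borel sets. The sets with approximable indicator
  include the open ones, an intersection-stable generator, and are closed under complements and
  countable disjoint unions, so Dynkin's argument covers all Borel sets.\<close>

lemma L2_space_unit_approximable: "L2_space unit_lebesgue \<subseteq> approximable unit_lebesgue \<int> expo"
proof (rule L2_space_approximable_if_indicator[OF expo_L2_unit finite_measure_unit])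
  let ?ind = "\<lambda>B t. complex_of_real (indicator B t)"
  have ind_L2: "?ind B \<in> L2_space unit_lebesgue" if "B \<in> sets borel" for B
    using that by (intro L2_space_bounded_finite_measure[OF finite_measure_unit, where C = 1])
      (auto simp: indicator_def)
  fix B assume "B \<in> sets unit_lebesgue"
  then have "B \<in> sigma_sets UNIV {S :: real set. open S}"
    by (simp add: borel_def)
  then show "?ind B \<in> approximable unit_lebesgue \<int> expo"
  proof (rule sigma_sets_induct_disjoint[where
      P = "\<lambda>B. ?ind B \<in> approximable unit_lebesgue \<int> expo", rotated 2])
    show "Int_stable {S :: real set. open S}" by (auto simp: Int_stable_def)
  next
    show "{S :: real set. open S} \<subseteq> Pow UNIV" by simp
  next
    fix G :: "real set" assume "G \<in> {S. open S}"
    then have G: "open G" by simp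
    show "?ind G \<in> approximable unit_lebesgue \<int> expo"
    proof (rule approximable_close[OF expo_L2_unit])
      show "?ind G \<in> L2_space unit_lebesgue" using G by (intro ind_L2) simp
      have [measurable]: "G \<in> sets borel" using G by simp
      have meas: "(\<lambda>t. (cmod (?ind G t - ?ind (G \<inter> {0<..<1}) t))\<^sup>2) \<in> borel_measurable borel"
        by measurable
      \<comment> \<open>Cutting \<open>G\<close> down to the open unit interval changes the
        indicator only on a null set of the measure.\<close>
      have "(LINT t|unit_lebesgue. (cmod (?ind G t - ?ind (G \<inter> {0<..<1}) t))\<^sup>2)
          = (LINT t|unit_lebesgue. 0)"
      proof (rule integral_cong_AE)
        show "AE t in unit_lebesgue. (cmod (?ind G t - ?ind (G \<inter> {0<..<1}) t))\<^sup>2 = 0"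
          using AE_unit_open by eventually_elim (auto simp: indicator_def)
      qed (use meas in simp_all)
      then show "\<exists>g\<in>approximable unit_lebesgue \<int> expo.
          (LINT t|unit_lebesgue. (cmod (?ind G t - g t))\<^sup>2) < \<delta>" if "\<delta> > 0" for \<delta>
        using that G by (intro bexI[OF _ open_indicator_approximable[of "G \<inter> {0<..<1}"]]) auto
    qed
  next
    show "?ind {} \<in> approximable unit_lebesgue \<int> expo"
      using open_indicator_approximable[of "{}"] by simp
  next
    fix B :: "real set" assume "?ind B \<in> approximable unit_lebesgue \<int> expo"
    then have "(\<lambda>t. (- 1) * ?ind B t) \<in> approximable unit_lebesgue \<int> expo"
      by (rule approximable_scale[OF expo_L2_unit])
    moreover have "(\<lambda>t. 1 * expo 0 t) \<in> approximable unit_lebesgue \<int> expo"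
      by (intro lin_comb_approximable[OF expo_L2_unit] lin_comb_single) simp
    ultimately have "(\<lambda>t. 1 * expo 0 t + (- 1) * ?ind B t) \<in> approximable unit_lebesgue \<int> expo"
      by (intro approximable_add[OF expo_L2_unit])
    moreover have "(\<lambda>t. 1 * expo 0 t + (- 1) * ?ind B t) = ?ind (UNIV - B)"
      by (auto simp: indicator_def)
    ultimately show "?ind (UNIV - B) \<in> approximable unit_lebesgue \<int> expo" by simp
  next
    fix B :: "nat \<Rightarrow> real set"
    assume disj: "disjoint_family B" and sets: "range B \<subseteq> sigma_sets UNIV {S. open S}"
      and IH: "\<And>i. ?ind (B i) \<in> approximable unit_lebesgue \<int> expo"
    have B: "B i \<in> sets borel" for i using sets by (auto simp: borel_def)
    show "?ind (\<Union>i. B i) \<in> approximable unit_lebesgue \<int> expo"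
    proof (rule approximable_limit[OF expo_L2_unit])
      show "(\<lambda>t. \<Sum>i<n. ?ind (B i) t) \<in> approximable unit_lebesgue \<int> expo" for n
        by (intro approximable_sum[OF expo_L2_unit] IH)
      show "?ind (\<Union>i. B i) \<in> L2_space unit_lebesgue"
        using B by (intro ind_L2) auto
      \<comment> \<open>Disjointness makes the partial sums indicators again, which gives both the
        pointwise limit and the constant bound 1.\<close>
      have eq: "(\<Sum>i<n. ?ind (B i) t) = ?ind (\<Union>i<n. B i) t" for n t
        using disj
        by (subst indicator_UN_disjoint) (auto simp: disjoint_family_on_def)
      show "AE t in unit_lebesgue. (\<lambda>n. \<Sum>i<n. ?ind (B i) t) \<longlonglongrightarrow> ?ind (\<Union>i. B i) t"
        unfolding eq by (intro AE_I2 tendsto_of_real LIMSEQ_indicator_UN)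
      show "integrable unit_lebesgue (\<lambda>_. 1 :: real)"
        by (rule finite_measure.integrable_const[OF finite_measure_unit])
      show "AE t in unit_lebesgue. (cmod (?ind (\<Union>i. B i) t - (\<Sum>i<n. ?ind (B i) t)))\<^sup>2 \<le> 1" for n
        unfolding eq by (intro AE_I2) (auto simp: indicator_def)
    qed
  qed
qed


section \<open>Unions of unit cells\<close>

lemma countable_Ints_real: "countable (\<int> :: real set)"
  by (simp add: Ints_def)

text \<open>The map from \<open>[0,1)\<close> to the circle is injective, as two of its points
  differ by less than 1.\<close>

lemma finite_expo_1_fibres:
  assumes "finite R"
  shows "finite {s \<in> {0..<1}. expo s 1 \<in> R}"
proof (rule finite_imageD)
  show "finite ((\<lambda>s. expo s 1) ` {s \<in> {0..<1}. expo s 1 \<in> R})"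
    by (rule finite_subset[OF _ assms]) auto
  show "inj_on (\<lambda>s. expo s 1) {s \<in> {0..<1}. expo s 1 \<in> R}"
  proof (rule inj_onI)
    fix s t :: real
    assume st: "s \<in> {s \<in> {0..<1}. expo s 1 \<in> R}" "t \<in> {s \<in> {0..<1}. expo s 1 \<in> R}"
    assume "expo s 1 = expo t 1"
    then obtain k :: int where k: "s - t = k" unfolding expo_1_eq_iff by (auto elim: Ints_cases)
    with st have "real_of_int k > -1" "real_of_int k < 1" by auto
    then have "k = 0" by linarith
    with k show "s = t" by simp
  qed
qed

context
  fixes A :: "nat set"
  assumes finite_A: "finite A" and A_ne: "A \<noteq> {}"
begin

definition "cells = minkowski_sum (real ` A) {0..1}"

definition "cell a = {real a..real a + 1}"

lemma cells_eq: "cells = (\<Union>a\<in>A. cell a)"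
proof (intro equalityI subsetI)
  fix x assume "x \<in> (\<Union>a\<in>A. cell a)"
  then obtain a where "a \<in> A" "x - real a \<in> {0..1}" by (auto simp: cell_def)
  then show "x \<in> cells"
    unfolding cells_def minkowski_sum_def by (intro CollectI exI[of _ "real a"] exI[of _ "x - real a"]) auto
next
  fix x assume "x \<in> cells"
  then obtain a t where "a \<in> A" "t \<in> {0..1}" "x = real a + t"
    unfolding cells_def minkowski_sum_def by blast
  then show "x \<in> (\<Union>a\<in>A. cell a)"
    by (intro UN_I[of a]) (auto simp: cell_def)
qed

lemma compact_cells: "compact cells"
  unfolding cells_eq cell_def using finite_A by (intro compact_UN) auto

lemma cells_borel [measurable]: "cells \<in> sets borel"
  using compact_cells by (intro borel_closed compact_imp_closed)

lemma cell_borel [measurable]: "cell a \<in> sets borel"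
  by (simp add: cell_def)

text \<open>Closed cells of consecutive integers share an endpoint. Off the integers, a null set,
  the cells are disjoint and the indicators add up.\<close>

lemma AE_indicator_cells: "AE x in lborel. indicator cells x = (\<Sum>a\<in>A. indicator (cell a) x :: real)"
proof -
  have "AE x in lborel. x \<notin> (\<int> :: real set)"
    by (rule AE_not_in) (rule countable_imp_null_set_lborel[OF countable_Ints_real])
  then show ?thesis
  proof eventually_elim
    case (elim x)
    have one: "a = b" if "x \<in> cell a" "x \<in> cell b" for a b
    proof -
      have "x \<noteq> real n" for n using elim by auto
      moreover have "x \<noteq> real n + 1" for n using elim by (auto intro: Ints_add)
      ultimately have "real a < x" "x < real a + 1" "real b < x" "x < real b + 1"
        using that unfolding cell_def by (auto simp: less_le)
      then have "real a < real b + 1" "real b < real a + 1" by linarith+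
      then show ?thesis by linarith
    qed
    show ?case
    proof (cases "x \<in> cells")
      case True
      then obtain a where a: "a \<in> A" "x \<in> cell a" by (auto simp: cells_eq)
      have "(\<Sum>b\<in>A. indicator (cell b) x :: real) = (\<Sum>b\<in>A. if b = a then 1 else 0)"
        using one a by (intro sum.cong) (auto simp: indicator_def)
      also have "\<dots> = 1" using a finite_A by simp
      finally show ?thesis using True by simp
    next
      case False
      then show ?thesis by (auto simp: cells_eq indicator_def intro!: sum.neutral[symmetric])
    qed
  qed
qed

text \<open>Translation by \<open>real a\<close> carries the unit interval onto
  \<open>cell a\<close> and preserves Lebesgue measure.\<close>

lemma
  fixes f :: "real \<Rightarrow> 'b :: {banach, second_countable_topology}"
  assumes f [measurable]: "f \<in> borel_measurable borel"
  shows integrable_cell: "integrable lborel (\<lambda>x. indicator (cell a) x *\<^sub>R f x)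
      \<longleftrightarrow> integrable unit_lebesgue (\<lambda>t. f (real a + t))"
    and integral_cell: "(LINT x|lborel. indicator (cell a) x *\<^sub>R f x)
      = (LINT t|unit_lebesgue. f (real a + t))"
proof -
  let ?g = "\<lambda>x. indicator (cell a) x *\<^sub>R f x"
  \<comment> \<open>The factor 1 is kept so that the left side matches the affine substitution rule
    for \<open>lborel\<close> with slope 1.\<close>
  have eq: "?g (real a + 1 * t) = indicator {0..1} t *\<^sub>R f (real a + t)" for t
    by (simp add: cell_def indicator_def)
  have m: "(\<lambda>t. f (real a + t)) \<in> borel_measurable borel" by measurable
  show "integrable lborel ?g \<longleftrightarrow> integrable unit_lebesgue (\<lambda>t. f (real a + t))"
    using lborel_integrable_real_affine_iff[of 1 ?g "real a"] m
    unfolding eq by (simp add: integrable_lebesgue_part)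
  show "(LINT x|lborel. ?g x) = (LINT t|unit_lebesgue. f (real a + t))"
    using lborel_integral_real_affine[of 1 ?g "real a"] m
    unfolding eq by (simp add: integral_lebesgue_part)
qed

lemma integrable_cells:
  fixes f :: "real \<Rightarrow> 'b :: {banach, second_countable_topology}"
  assumes f [measurable]: "f \<in> borel_measurable borel"
  shows "integrable (lebesgue_part cells) f
    \<longleftrightarrow> (\<forall>a\<in>A. integrable unit_lebesgue (\<lambda>t. f (real a + t)))"
proof -
  have "integrable lborel (\<lambda>x. indicator cells x *\<^sub>R f x)
      \<longleftrightarrow> (\<forall>a\<in>A. integrable lborel (\<lambda>x. indicator (cell a) x *\<^sub>R f x))"
  proof safe
    fix a assume int: "integrable lborel (\<lambda>x. indicator cells x *\<^sub>R f x)" and a: "a \<in> A"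
    have "integrable lborel (\<lambda>x. indicator (cell a) x *\<^sub>R (indicator cells x *\<^sub>R f x))"
      by (rule integrable_mult_indicator[OF _ int]) simp
    also have "(\<lambda>x. indicator (cell a) x *\<^sub>R (indicator cells x *\<^sub>R f x)) = (\<lambda>x. indicator (cell a) x *\<^sub>R f x)"
      using a by (intro ext) (auto simp: cells_eq indicator_def)
    finally show "integrable lborel (\<lambda>x. indicator (cell a) x *\<^sub>R f x)" .
  next
    assume "\<forall>a\<in>A. integrable lborel (\<lambda>x. indicator (cell a) x *\<^sub>R f x)"
    then have "integrable lborel (\<lambda>x. \<Sum>a\<in>A. indicator (cell a) x *\<^sub>R f x)"
      by (intro Bochner_Integration.integrable_sum) auto
    then show "integrable lborel (\<lambda>x. indicator cells x *\<^sub>R f x)"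
    proof (rule integrable_cong_AE_imp)
      show "AE x in lborel. (\<Sum>a\<in>A. indicator (cell a) x *\<^sub>R f x) = indicator cells x *\<^sub>R f x"
        using AE_indicator_cells by eventually_elim (simp add: scaleR_left.sum)
    qed measurable
  qed
  then show ?thesis by (simp add: integrable_lebesgue_part integrable_cell)
qed

lemma integral_cells:
  fixes f :: "real \<Rightarrow> 'b :: {banach, second_countable_topology}"
  assumes f [measurable]: "f \<in> borel_measurable borel"
    and int: "\<And>a. a \<in> A \<Longrightarrow> integrable unit_lebesgue (\<lambda>t. f (real a + t))"
  shows "integral\<^sup>L (lebesgue_part cells) f = (\<Sum>a\<in>A. LINT t|unit_lebesgue. f (real a + t))"
proof -
  have "integral\<^sup>L (lebesgue_part cells) f = (LINT x|lborel. indicator cells x *\<^sub>R f x)"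
    by (simp add: integral_lebesgue_part)
  also have "\<dots> = (LINT x|lborel. (\<Sum>a\<in>A. indicator (cell a) x *\<^sub>R f x))"
  proof (rule integral_cong_AE)
    show "AE x in lborel. indicator cells x *\<^sub>R f x = (\<Sum>a\<in>A. indicator (cell a) x *\<^sub>R f x)"
      using AE_indicator_cells by eventually_elim (simp add: scaleR_left.sum)
  qed measurable
  also have "\<dots> = (\<Sum>a\<in>A. LINT x|lborel. indicator (cell a) x *\<^sub>R f x)"
    using int by (intro Bochner_Integration.integral_sum) (simp add: integrable_cell)
  finally show ?thesis by (simp add: integral_cell)
qed

lemma emeasure_cells: "0 < emeasure lebesgue cells" "emeasure lebesgue cells < \<infinity>"
proof -
  obtain a where a: "a \<in> A" using A_ne by auto
  have "0 < emeasure lborel (cell a)" by (simp add: cell_def)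
  also have "\<dots> \<le> emeasure lborel cells" using a by (intro emeasure_mono) (auto simp: cells_eq)
  finally show "0 < emeasure lebesgue cells" by simp
  show "emeasure lebesgue cells < \<infinity>"
    using emeasure_compact_finite[OF compact_cells] by simp
qed

lemma finite_measure_cells: "finite_measure (lebesgue_part cells)"
  using emeasure_cells(2) by (intro finite_measure_lebesgue_part) auto

lemma spectrum_of_domain_cells:
  "spectrum_of_domain cells \<Lambda> \<longleftrightarrow> orthogonal_basis_L2 (lebesgue_part cells) \<Lambda> expo"
  using emeasure_cells finite_measure_cells
  by (simp add: spectrum_of_domain_def spectrum_of_measure_def)

section \<open>The mask, its zeros and orthogonality of exponentials on the cells\<close>

definition mask :: "real \<Rightarrow> complex" where
  "mask s = (\<Sum>a\<in>A. expo s (real a))"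

lemma mask_add_Ints: "k \<in> \<int> \<Longrightarrow> mask (s + k) = mask s"
  by (simp add: mask_def expo_add_left expo_Ints)

lemma mask_Ints: "k \<in> \<int> \<Longrightarrow> mask k \<noteq> 0"
  using finite_A A_ne by (simp add: mask_def expo_Ints)

text \<open>The mask at \<open>s\<close> is the value at \<open>expo s 1\<close> of the polynomial
  with coefficient 1 at each exponent in \<open>A\<close>. It is nonzero since \<open>A\<close> is
  nonempty, so it has finitely many roots.\<close>

lemma finite_mask_zeros: obtains R where "finite R" "\<And>s. mask s = 0 \<Longrightarrow> expo s 1 \<in> R"
proof
  define p where "p = (\<Sum>a\<in>A. monom (1 :: complex) a)"
  obtain a where a: "a \<in> A" using A_ne by auto
  have "coeff p a = (\<Sum>b\<in>A. if b = a then 1 else 0)"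
    by (simp add: p_def coeff_sum)
  with a finite_A have "p \<noteq> 0" by auto
  then show "finite {z. poly p z = 0}" by (rule poly_roots_finite)
  show "expo s 1 \<in> {z. poly p z = 0}" if "mask s = 0" for s
    using that by (simp add: mask_def p_def poly_sum poly_monom expo_of_nat)
qed

text \<open>On the cell of \<open>a\<close> the exponential splits as
  \<open>expo s (real a) * expo s t\<close>; the integral over \<open>t\<close> is common to all
  cells and the remaining sum is the mask.\<close>

lemma inner_cells_expo:
  "inner_L2 (lebesgue_part cells) (expo l) (expo m) = mask (l - m) * (LINT t|unit_lebesgue. expo (l - m) t)"
proof -
  have int: "integrable unit_lebesgue (expo s)" for s
    by (rule finite_measure.integrable_const_bound[OF finite_measure_unit, where B = 1]) auto
  have "inner_L2 (lebesgue_part cells) (expo l) (expo m)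
      = (\<Sum>a\<in>A. LINT t|unit_lebesgue. expo (l - m) (real a + t))"
    unfolding inner_expo using int by (subst integral_cells) (auto simp: expo_add_right)
  then show ?thesis by (simp add: expo_add_right mask_def sum_distrib_right)
qed

lemma inner_cells_expo_eq_0:
  "inner_L2 (lebesgue_part cells) (expo l) (expo m) = 0 \<longleftrightarrow> mask (l - m) = 0 \<or> l - m \<in> \<int> \<and> l \<noteq> m"
  by (simp add: inner_cells_expo integral_expo_unit)

lemma expo_L2_cells: "expo l \<in> L2_space (lebesgue_part cells)"
  by (intro expo_L2 finite_measure_cells) simp

lemma norm_cells_expo: "norm_L2 (lebesgue_part cells) (expo l) \<noteq> 0"
proof -
  have "emeasure (lebesgue_part cells) UNIV = emeasure lebesgue cells"
    by (subst emeasure_lebesgue_part) auto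
  then have "measure (lebesgue_part cells) UNIV > 0"
    using emeasure_cells by (simp add: measure_def enn2real_positive_iff)
  then show ?thesis by (simp add: norm_L2_def)
qed

section \<open>The uniform measure on the atoms and its Fourier coefficients\<close>

abbreviation "atoms \<equiv> uniform_atomic (real ` A)"

lemma sets_atoms [simp]: "sets atoms = sets borel"
  by (simp add: uniform_atomic_def)

lemma borel_measurable_atoms [simp]: "borel_measurable atoms = borel_measurable borel"
  by (rule measurable_cong_sets) auto

lemma id_measurable_count: "(\<lambda>x. x) \<in> measurable (uniform_count_measure (real ` A)) borel"
  by (simp add: measurable_def sets_uniform_count_measure space_uniform_count_measure)

lemma integral_atoms:
  fixes f :: "real \<Rightarrow> 'b :: {banach, second_countable_topology}"
  assumes "f \<in> borel_measurable borel"
  shows "integral\<^sup>L atoms f = (\<Sum>a\<in>A. f (real a)) /\<^sub>R real (card A)"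
proof -
  have "integral\<^sup>L atoms f = integral\<^sup>L (uniform_count_measure (real ` A)) f"
    unfolding uniform_atomic_def using id_measurable_count assms by (subst integral_distr) auto
  also have "\<dots> = (\<Sum>x\<in>real ` A. (1 / real (card (real ` A))) *\<^sub>R f x)"
    unfolding uniform_count_measure_def using finite_A
    by (subst lebesgue_integral_point_measure_finite) auto
  also have "\<dots> = (\<Sum>a\<in>A. f (real a)) /\<^sub>R real (card A)"
    by (simp add: sum.reindex inj_on_def card_image scaleR_right.sum divide_inverse)
  finally show ?thesis .
qed

lemma integrable_atoms:
  fixes f :: "real \<Rightarrow> 'b :: {banach, second_countable_topology}"
  assumes "f \<in> borel_measurable borel"
  shows "integrable atoms f"
proof -
  have "integrable (uniform_count_measure (real ` A)) f"
    unfolding uniform_count_measure_def using finite_A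
    by (intro integrable_point_measure_finite) auto
  then show ?thesis
    unfolding uniform_atomic_def using id_measurable_count assms by (subst integrable_distr_eq) auto
qed

lemma finite_measure_atoms: "finite_measure atoms"
proof (rule finite_measureI)
  have "emeasure atoms UNIV = ennreal (1 / card (real ` A) * (\<Sum>a\<in>real ` A. indicator UNIV a))"
    using finite_A A_ne by (intro emeasure_uniform_atomic) auto
  then show "emeasure atoms (space atoms) \<noteq> \<infinity>" by (simp add: uniform_atomic_def)
qed

text \<open>Only finitely many values count, so square integrability is automatic.\<close>

lemma L2_space_atoms: "L2_space atoms = borel_measurable borel"
  by (auto simp: L2_space_def intro!: integrable_atoms)

lemma spectrum_of_finite_set_atoms:
  "spectrum_of_finite_set (real ` A) \<Lambda> \<longleftrightarrow> orthogonal_basis_L2 atoms \<Lambda> expo"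
  using finite_A A_ne finite_measure_atoms
  by (simp add: spectrum_of_finite_set_def spectrum_of_measure_def)

lemma inner_atoms:
  assumes [measurable]: "f \<in> borel_measurable borel" "g \<in> borel_measurable borel"
  shows "inner_L2 atoms f g = 0 \<longleftrightarrow> (\<Sum>a\<in>A. f (real a) * cnj (g (real a))) = 0"
  using finite_A A_ne by (simp add: inner_L2_def integral_atoms)

lemma inner_atoms_expo: "inner_L2 atoms (expo l) (expo m) = 0 \<longleftrightarrow> mask (l - m) = 0"
  by (simp add: inner_atoms expo_mult_cnj mask_def)

lemma norm_atoms:
  assumes [measurable]: "f \<in> borel_measurable borel"
  shows "norm_L2 atoms f = 0 \<longleftrightarrow> (\<forall>a\<in>A. f (real a) = 0)"
  using finite_A A_ne by (simp add: norm_L2_def integral_atoms sum_nonneg_eq_0_iff)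

lemma norm_atoms_expo: "norm_L2 atoms (expo l) \<noteq> 0"
  using A_ne by (auto simp: norm_atoms)

text \<open>Fix one frequency \<open>m\<close>. The others differ from it by zeros of the mask,
  which give finitely many points of the circle, and no two frequencies can give the same point
  because the mask does not vanish at integers.\<close>

lemma finite_orthogonal:
  assumes "\<And>l m. l \<in> \<Lambda> \<Longrightarrow> m \<in> \<Lambda> \<Longrightarrow> l \<noteq> m \<Longrightarrow> mask (l - m) = 0"
  shows "finite \<Lambda>"
proof (cases "\<Lambda> = {}")
  case False
  then obtain m where m: "m \<in> \<Lambda>" by auto
  obtain R where R: "finite R" "\<And>s. mask s = 0 \<Longrightarrow> expo s 1 \<in> R" using finite_mask_zeros by blast
  show ?thesis
  proof (rule finite_imageD)
    have "(\<lambda>l. expo (l - m) 1) ` \<Lambda> \<subseteq> insert 1 R"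
      using assms[OF _ m] R(2) by (auto, metis diff_self expo_0(1))
    then show "finite ((\<lambda>l. expo (l - m) 1) ` \<Lambda>)" using R(1) finite_subset by blast
    show "inj_on (\<lambda>l. expo (l - m) 1) \<Lambda>"
    proof (rule inj_onI, rule ccontr)
      fix l l' assume l: "l \<in> \<Lambda>" "l' \<in> \<Lambda>" "expo (l - m) 1 = expo (l' - m) 1" "l \<noteq> l'"
      then have "l - l' \<in> \<int>" by (simp add: expo_1_eq_iff)
      with mask_Ints assms l show False by blast
    qed
  qed
qed simp

text \<open>The Fourier coefficient, that is, the inner product of \<open>f\<close> with
  \<open>expo l\<close> over the uniform measure, for which \<open>expo l\<close> has norm
  1.\<close>

definition coefficient :: "(real \<Rightarrow> complex) \<Rightarrow> real \<Rightarrow> complex" where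
  "coefficient f l = (\<Sum>a\<in>A. f (real a) * cnj (expo l (real a))) / of_nat (card A)"

text \<open>Subtracting the orthogonal projection onto the span of the frequencies leaves a vector
  orthogonal to each of them; pairwise orthogonality kills all terms but
  \<open>l = m\<close>.\<close>

lemma residual_orthogonal:
  assumes "finite \<Lambda>" "m \<in> \<Lambda>"
    and orth: "\<And>l m. l \<in> \<Lambda> \<Longrightarrow> m \<in> \<Lambda> \<Longrightarrow> l \<noteq> m \<Longrightarrow> mask (l - m) = 0"
  shows "(\<Sum>a\<in>A. (f (real a) - (\<Sum>l\<in>\<Lambda>. coefficient f l * expo l (real a))) * cnj (expo m (real a))) = 0"
proof -
  have "(\<Sum>a\<in>A. (\<Sum>l\<in>\<Lambda>. coefficient f l * expo l (real a)) * cnj (expo m (real a)))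
     = (\<Sum>l\<in>\<Lambda>. coefficient f l * mask (l - m))"
    unfolding mask_def sum_distrib_left sum_distrib_right
    by (subst sum.swap) (simp add: mult.assoc expo_mult_cnj)
  also have "\<dots> = (\<Sum>l\<in>\<Lambda>. if l = m then coefficient f m * of_nat (card A) else 0)"
    using orth assms(2) by (intro sum.cong) (auto simp: mask_def)
  also have "\<dots> = (\<Sum>a\<in>A. f (real a) * cnj (expo m (real a)))"
    using assms finite_A A_ne by (simp add: coefficient_def)
  finally show ?thesis by (simp add: left_diff_distrib sum_subtractf)
qed

section \<open>Spectra\<close>

text \<open>If \<open>l + k\<close> were missing, its exponential would be orthogonal to the whole
  basis: the mask ignores integer shifts, and a nonzero integer difference is a zero of the
  transform of the unit interval. Completeness would then give it norm 0.\<close>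

lemma domain_spectrum_periodic:
  assumes spec: "spectrum_of_domain cells \<Lambda>" and l: "l \<in> \<Lambda>" and k: "k \<in> \<int>"
  shows "l + k \<in> \<Lambda>"
proof (rule ccontr)
  assume notin: "l + k \<notin> \<Lambda>"
  have basis: "orthogonal_basis_L2 (lebesgue_part cells) \<Lambda> expo"
    using spec by (simp add: spectrum_of_domain_cells)
  have "norm_L2 (lebesgue_part cells) (expo (l + k)) = 0"
  proof (rule orthogonal_basis_L2_complete[OF basis expo_L2_cells])
    fix m assume m: "m \<in> \<Lambda>"
    show "inner_L2 (lebesgue_part cells) (expo (l + k)) (expo m) = 0"
    proof (cases "l = m")
      case True
      then show ?thesis using k notin l m by (auto simp: inner_cells_expo_eq_0)
    next
      case False
      then have "inner_L2 (lebesgue_part cells) (expo l) (expo m) = 0"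
        using basis l m by (auto simp: orthogonal_basis_L2_def)
      then consider "mask (l - m) = 0" | "l - m \<in> \<int>" by (auto simp: inner_cells_expo_eq_0)
      then show ?thesis
      proof cases
        case 1
        then have "mask (l - m + k) = 0" using mask_add_Ints[OF k] by simp
        then show ?thesis by (simp add: inner_cells_expo_eq_0 algebra_simps)
      next
        case 2
        then have "l - m + k \<in> \<int>" using k by simp
        moreover have "l + k \<noteq> m" using m notin by auto
        ultimately show ?thesis by (simp add: inner_cells_expo_eq_0 algebra_simps)
      qed
    qed
  qed
  then show False using norm_cells_expo by simp
qed

text \<open>By periodicity the part in \<open>[0,1)\<close> represents \<open>\<Lambda>\<close>
  modulo integers. Two of its points never differ by a nonzero integer, so their orthogonality on
  the cells must come from the mask. This is stated as a conclusion because the finiteness of the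
  number of spectra rests on it.\<close>

lemma finite_set_spectrum_of_domain_spectrum:
  assumes spec: "spectrum_of_domain cells \<Lambda>"
  defines "\<Lambda>\<^sub>A \<equiv> \<Lambda> \<inter> {0..<1}"
  shows "\<Lambda> = minkowski_sum \<int> \<Lambda>\<^sub>A" "spectrum_of_finite_set (real ` A) \<Lambda>\<^sub>A"
    "l \<in> \<Lambda>\<^sub>A \<Longrightarrow> m \<in> \<Lambda>\<^sub>A \<Longrightarrow> l \<noteq> m \<Longrightarrow> mask (l - m) = 0"
proof -
  have basis: "orthogonal_basis_L2 (lebesgue_part cells) \<Lambda> expo"
    using spec by (simp add: spectrum_of_domain_cells)
  show \<Lambda>: "\<Lambda> = minkowski_sum \<int> \<Lambda>\<^sub>A"
  proof (intro equalityI subsetI)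
    fix l assume "l \<in> \<Lambda>"
    then have "l + of_int (- \<lfloor>l\<rfloor>) \<in> \<Lambda>" by (intro domain_spectrum_periodic[OF spec]) auto
    then have "frac l \<in> \<Lambda>\<^sub>A" by (simp add: \<Lambda>\<^sub>A_def frac_def frac_lt_1[unfolded frac_def])
    then show "l \<in> minkowski_sum \<int> \<Lambda>\<^sub>A"
      unfolding minkowski_sum_def
      by (intro CollectI exI[of _ "of_int \<lfloor>l\<rfloor>"] exI[of _ "frac l"]) (auto simp: frac_def)
  next
    fix l assume "l \<in> minkowski_sum \<int> \<Lambda>\<^sub>A"
    then obtain k m where "l = k + m" "k \<in> \<int>" "m \<in> \<Lambda>" by (auto simp: minkowski_sum_def \<Lambda>\<^sub>A_def)
    then show "l \<in> \<Lambda>" using domain_spectrum_periodic[OF spec, of m k] by (simp add: add.commute)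
  qed
  show orth: "mask (l - m) = 0" if "l \<in> \<Lambda>\<^sub>A" "m \<in> \<Lambda>\<^sub>A" "l \<noteq> m" for l m
  proof -
    have "inner_L2 (lebesgue_part cells) (expo l) (expo m) = 0"
      using basis that by (auto simp: orthogonal_basis_L2_def \<Lambda>\<^sub>A_def)
    moreover have "l - m \<notin> \<int>"
    proof
      assume "l - m \<in> \<int>"
      then obtain k :: int where k: "l - m = k" by (auto elim: Ints_cases)
      with that have "real_of_int k > -1" "real_of_int k < 1" by (auto simp: \<Lambda>\<^sub>A_def)
      then have "k = 0" by linarith
      with k that show False by simp
    qed
    ultimately show ?thesis by (simp add: inner_cells_expo_eq_0)
  qed
  have fin: "finite \<Lambda>\<^sub>A" using orth by (rule finite_orthogonal)
  have "\<exists>F c. finite F \<and> F \<subseteq> \<Lambda>\<^sub>A \<and> norm_L2 atoms (\<lambda>x. f x - (\<Sum>l\<in>F. c l * expo l x)) < \<epsilon>"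
    if [measurable]: "f \<in> borel_measurable borel" and "\<epsilon> > 0" for f and \<epsilon> :: real
  proof -
    \<comment> \<open>The residual of the projection onto the candidate spectrum. It is shown to
      vanish on \<open>A\<close>, so the projection is an exact expansion and serves for every
      \<epsilon>.\<close>
    define g where "g x = f x - (\<Sum>l\<in>\<Lambda>\<^sub>A. coefficient f l * expo l x)" for x
    have [measurable]: "g \<in> borel_measurable borel" unfolding g_def by measurable
    \<comment> \<open>Extends the values of \<open>g\<close> on \<open>A\<close> to the cells by
      constants; the floor makes the extension Borel measurable at once.\<close>
    define G where "G x = g (of_int \<lfloor>x\<rfloor>)" for x :: real
    have [measurable]: "G \<in> borel_measurable borel" unfolding G_def by measurable
    have G: "AE t in unit_lebesgue. G (real a + t) = g (real a)" for a
      using AE_unit_open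
    proof eventually_elim
      case (elim t)
      then have "\<lfloor>real a + t\<rfloor> = int a" by (simp add: floor_eq_iff)
      then show ?case by (simp add: G_def)
    qed
    have const: "integrable unit_lebesgue (\<lambda>t. c)" for c :: "'c :: {banach, second_countable_topology}"
      by (rule finite_measure.integrable_const[OF finite_measure_unit])
    have norm_int: "integrable unit_lebesgue (\<lambda>t. (cmod (G (real a + t)))\<^sup>2)" for a
    proof (rule integrable_cong_AE_imp[OF const])
      show "AE t in unit_lebesgue. (cmod (g (real a)))\<^sup>2 = (cmod (G (real a + t)))\<^sup>2"
        using G[of a] by eventually_elim simp
    qed measurable
    have GL2: "G \<in> L2_space (lebesgue_part cells)"
      using norm_int by (simp add: L2_space_def integrable_cells)
    have "norm_L2 (lebesgue_part cells) G = 0"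
    proof (rule orthogonal_basis_L2_complete[OF basis GL2])
      fix l assume "l \<in> \<Lambda>"
      then obtain k m where l: "l = k + m" "k \<in> \<int>" "m \<in> \<Lambda>\<^sub>A"
        unfolding \<Lambda> by (auto simp: minkowski_sum_def)
      let ?h = "\<lambda>x. G x * cnj (expo l x)"
      have [measurable]: "?h \<in> borel_measurable borel" by measurable
      \<comment> \<open>As \<open>k\<close> and \<open>a\<close> are integers, \<open>expo l\<close>
        and \<open>expo m\<close> agree at \<open>real a\<close>. The inner product thus factors
        into the sum orthogonality of \<open>g\<close> controls and an integral independent of
        \<open>a\<close>.\<close>
      have AE: "AE t in unit_lebesgue. ?h (real a + t)
          = g (real a) * cnj (expo m (real a)) * cnj (expo l t)" for a
        using G[of a] by eventually_elim (simp add: l expo_add_right expo_add_left expo_Ints)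
      have int: "integrable unit_lebesgue (\<lambda>t. c * cnj (expo l t))" for c
        by (rule finite_measure.integrable_const_bound[OF finite_measure_unit, where B = "cmod c"])
           (auto simp: norm_mult)
      have "integrable unit_lebesgue (\<lambda>t. ?h (real a + t))" for a
      proof (rule integrable_cong_AE_imp[OF int])
        show "AE t in unit_lebesgue. g (real a) * cnj (expo m (real a)) * cnj (expo l t)
          = ?h (real a + t)"
          using AE[of a] by eventually_elim simp
      qed measurable
      then have "inner_L2 (lebesgue_part cells) G (expo l)
          = (\<Sum>a\<in>A. LINT t|unit_lebesgue. ?h (real a + t))"
        unfolding inner_L2_def by (intro integral_cells) auto
      also have "\<dots> = (\<Sum>a\<in>A. LINT t|unit_lebesgue. g (real a) * cnj (expo m (real a)) * cnj (expo l t))"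
        using AE by (intro sum.cong refl integral_cong_AE) auto
      also have "\<dots> = (\<Sum>a\<in>A. g (real a) * cnj (expo m (real a))) * (LINT t|unit_lebesgue. cnj (expo l t))"
        by (simp add: sum_distrib_right)
      also have "(\<Sum>a\<in>A. g (real a) * cnj (expo m (real a))) = 0"
        unfolding g_def using orth by (intro residual_orthogonal fin l)
      finally show "inner_L2 (lebesgue_part cells) G (expo l) = 0" by simp
    qed
    then have "0 = (LINT x|lebesgue_part cells. (cmod (G x))\<^sup>2)"
      by (simp add: norm_L2_def)
    also have "\<dots> = (\<Sum>a\<in>A. LINT t|unit_lebesgue. (cmod (G (real a + t)))\<^sup>2)"
      using norm_int by (intro integral_cells) auto
    also have "\<dots> = (\<Sum>a\<in>A. LINT t|unit_lebesgue. (cmod (g (real a)))\<^sup>2)"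
    proof (intro sum.cong refl integral_cong_AE)
      show "AE t in unit_lebesgue. (cmod (G (real a + t)))\<^sup>2 = (cmod (g (real a)))\<^sup>2" for a
        using G[of a] by eventually_elim simp
    qed auto
    also have "\<dots> = (\<Sum>a\<in>A. (cmod (g (real a)))\<^sup>2)"
      by (simp add: measure_unit)
    finally have "\<forall>a\<in>A. g (real a) = 0"
      using finite_A by (simp add: sum_nonneg_eq_0_iff)
    then have "norm_L2 atoms g = 0" by (simp add: norm_atoms)
    then show ?thesis
      using fin \<open>\<epsilon> > 0\<close> unfolding g_def
      by (intro exI[of _ \<Lambda>\<^sub>A] exI[of _ "coefficient f"]) auto
  qed
  then show "spectrum_of_finite_set (real ` A) \<Lambda>\<^sub>A"
    unfolding spectrum_of_finite_set_atoms orthogonal_basis_L2_def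
    by (auto simp: L2_space_atoms inner_atoms_expo norm_atoms_expo orth)
qed

text \<open>The residual of the projection is orthogonal to the basis, hence null, and a null
  function for the atomic measure vanishes at every atom.\<close>

lemma finite_set_spectrum_expansion:
  assumes spec: "spectrum_of_finite_set (real ` A) \<Lambda>" and fin: "finite \<Lambda>"
    and [measurable]: "f \<in> borel_measurable borel" and a: "a \<in> A"
  shows "f (real a) = (\<Sum>l\<in>\<Lambda>. coefficient f l * expo l (real a))"
proof -
  have basis: "orthogonal_basis_L2 atoms \<Lambda> expo"
    using spec by (simp add: spectrum_of_finite_set_atoms)
  have orth: "mask (l - m) = 0" if "l \<in> \<Lambda>" "m \<in> \<Lambda>" "l \<noteq> m" for l m
    using basis that by (auto simp: orthogonal_basis_L2_def inner_atoms_expo)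
  define g where "g x = f x - (\<Sum>l\<in>\<Lambda>. coefficient f l * expo l x)" for x
  have [measurable]: "g \<in> borel_measurable borel" unfolding g_def by measurable
  have "norm_L2 atoms g = 0"
  proof (rule orthogonal_basis_L2_complete[OF basis])
    show "g \<in> L2_space atoms" by (simp add: L2_space_atoms)
    show "inner_L2 atoms g (expo m) = 0" if "m \<in> \<Lambda>" for m
      using residual_orthogonal[OF fin that orth, of f] by (simp add: inner_atoms g_def)
  qed
  then show ?thesis using a by (simp add: norm_atoms g_def)
qed

text \<open>Orthogonality follows from the factorization of inner products. For density,
  \<open>f\<close> is expanded over \<open>\<Lambda>\<close> on each translate of \<open>A\<close>,
  and the coefficient functions on the unit interval are replaced by trigonometric
  polynomials.\<close>

lemma domain_spectrum_of_finite_set_spectrum: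
  assumes spec: "spectrum_of_finite_set (real ` A) \<Lambda>"
  shows "spectrum_of_domain cells (minkowski_sum \<int> \<Lambda>)"
  unfolding spectrum_of_domain_cells
proof (rule orthogonal_basis_L2I)
  let ?M = "lebesgue_part cells"
  let ?S = "minkowski_sum \<int> \<Lambda>"
  have orth: "mask (l - m) = 0" if "l \<in> \<Lambda>" "m \<in> \<Lambda>" "l \<noteq> m" for l m
    using spec that
    by (auto simp: spectrum_of_finite_set_atoms orthogonal_basis_L2_def inner_atoms_expo)
  have fin: "finite \<Lambda>" using orth by (rule finite_orthogonal)
  show "expo l \<in> L2_space ?M" "norm_L2 ?M (expo l) \<noteq> 0" for l
    by (rule expo_L2_cells norm_cells_expo)+
  show "inner_L2 ?M (expo i) (expo j) = 0" if "i \<in> ?S" "j \<in> ?S" "i \<noteq> j" for i j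
  proof -
    obtain k l k' l' where kl: "i = k + l" "j = k' + l'" "k \<in> \<int>" "k' \<in> \<int>" "l \<in> \<Lambda>" "l' \<in> \<Lambda>"
      using \<open>i \<in> ?S\<close> \<open>j \<in> ?S\<close> unfolding minkowski_sum_def by blast
    show ?thesis
    proof (cases "l = l'")
      case True
      then show ?thesis using kl \<open>i \<noteq> j\<close> by (simp add: inner_cells_expo_eq_0)
    next
      case False
      then have "mask (l - l' + (k - k')) = 0" using kl orth by (simp add: mask_add_Ints)
      then show ?thesis by (simp add: inner_cells_expo_eq_0 kl algebra_simps)
    qed
  qed
  show "L2_space ?M \<subseteq> approximable ?M ?S expo"
  proof
    fix f assume f: "f \<in> L2_space ?M"
    then have [measurable]: "f \<in> borel_measurable borel" by (simp add: L2_space_def)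
    have f_unit: "(\<lambda>t. f (real a + t)) \<in> L2_space unit_lebesgue" if "a \<in> A" for a
      using f that by (simp add: L2_space_def integrable_cells)
    \<comment> \<open>The coefficient of the fiber over \<open>t\<close>, turned by the conjugate of
      \<open>expo l t\<close>. With this twist the expansion uses \<open>expo l\<close> at
      \<open>real a + t\<close>, and \<open>H l\<close> depends on \<open>t\<close> alone.\<close>
    define H where "H l t = cnj (expo l t) * coefficient (\<lambda>x. f (x + t)) l" for l t
    have H_eq: "H l = (\<lambda>t. \<Sum>a\<in>A. (cnj (expo l (real a)) / of_nat (card A)) * (cnj (expo l t) * f (real a + t)))" for l
      by (simp add: H_def coefficient_def sum_distrib_left sum_divide_distrib mult_ac fun_eq_iff)
    have H_L2: "H l \<in> L2_space unit_lebesgue" for l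
      unfolding H_eq
      by (intro L2_space_sum L2_space_scale L2_space_mult_bounded[where C = 1] f_unit) auto
    have f_eq: "f (real a + t) = (\<Sum>l\<in>\<Lambda>. expo l (real a + t) * H l t)" if "a \<in> A" for a t
    proof -
      have "f (real a + t) = (\<Sum>l\<in>\<Lambda>. coefficient (\<lambda>x. f (x + t)) l * expo l (real a))"
        using finite_set_spectrum_expansion[OF spec fin _ that, of "\<lambda>x. f (x + t)"] by simp
      also have "\<dots> = (\<Sum>l\<in>\<Lambda>. expo l (real a + t) * H l t)"
      proof (rule sum.cong)
        fix l
        have "expo l t * cnj (expo l t) = 1" by (simp add: expo_mult_cnj)
        then show "coefficient (\<lambda>x. f (x + t)) l * expo l (real a) = expo l (real a + t) * H l t"
          by (simp add: H_def expo_add_right mult_ac)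
      qed simp
      finally show ?thesis .
    qed
    have "\<exists>P\<in>lin_comb ?S expo. (LINT x|?M. (cmod (f x - P x))\<^sup>2) < \<delta>" if \<delta>: "\<delta> > 0" for \<delta>
    proof -
      define n where "n = real (card \<Lambda>)"
      \<comment> \<open>The total error is at most \<open>card A * n * n * \<eta>\<close>: one
        factor \<open>n\<close> comes from Cauchy-Schwarz, the other from summing over
        \<open>\<Lambda>\<close>. The added 1 keeps the divisor positive and makes the final
        inequality strict.\<close>
      define \<eta> where "\<eta> = \<delta> / (real (card A) * n * n + 1)"
      have pos: "real (card A) * n * n + 1 > 0" by (simp add: n_def add_nonneg_pos)
      then have \<eta>: "\<eta> > 0" using \<delta> by (simp add: \<eta>_def)
      have "\<exists>p\<in>lin_comb \<int> expo. (LINT t|unit_lebesgue. (cmod (H l t - p t))\<^sup>2) < \<eta>" for l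
        using L2_space_unit_approximable H_L2 approximableD(2)[OF _ \<eta>] by blast
      then obtain p where p: "\<And>l. p l \<in> lin_comb \<int> expo"
        "\<And>l. (LINT t|unit_lebesgue. (cmod (H l t - p l t))\<^sup>2) < \<eta>"
        by metis
      have p_L2: "p l \<in> L2_space unit_lebesgue" for l
        by (rule L2_space_lin_comb[OF expo_L2_unit p(1)])
      have [measurable]: "p l \<in> borel_measurable borel" for l
        using p_L2 by (simp add: L2_space_def)
      \<comment> \<open>Integer frequencies give period 1, so one polynomial approximates
        \<open>H l\<close> on all cells simultaneously.\<close>
      have p_shift: "p l (real a + t) = p l t" for l a t
      proof -
        obtain F c where "F \<subseteq> \<int>" "p l = (\<lambda>x. \<Sum>i\<in>F. c i * expo i x)"
          using p(1)[of l] by (auto simp: lin_comb_def)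
        then show ?thesis by (auto simp: expo_add_right expo_Ints intro!: sum.cong)
      qed
      define P where "P x = (\<Sum>l\<in>\<Lambda>. expo l x * p l x)" for x
      have [measurable]: "P \<in> borel_measurable borel" unfolding P_def by measurable
      have "(\<lambda>x. expo l x * p l x) \<in> lin_comb ?S expo" if "l \<in> \<Lambda>" for l
      proof -
        obtain F c where F: "F \<subseteq> \<int>" "p l = (\<lambda>x. \<Sum>i\<in>F. c i * expo i x)"
          using p(1)[of l] by (auto simp: lin_comb_def)
        have "(\<lambda>x. expo l x * p l x) = (\<lambda>x. \<Sum>i\<in>F. c i * expo (i + l) x)"
          by (simp add: F(2) sum_distrib_left expo_add_left mult_ac)
        also have "\<dots> \<in> lin_comb ?S expo"
          using F(1) that by (intro lin_comb_sum lin_comb_single) (auto simp: minkowski_sum_def)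
        finally show ?thesis .
      qed
      then have P: "P \<in> lin_comb ?S expo"
        unfolding P_def by (rule lin_comb_sum)
      let ?E = "\<lambda>t. \<Sum>l\<in>\<Lambda>. (cmod (H l t - p l t))\<^sup>2"
      have Hp_int: "integrable unit_lebesgue (\<lambda>t. (cmod (H l t - p l t))\<^sup>2)" for l
        by (rule L2_spaceD(2)[OF L2_space_diff[OF H_L2 p_L2]])
      then have E_int: "integrable unit_lebesgue (\<lambda>t. n * ?E t)" by simp
      have bound: "(cmod (f (real a + t) - P (real a + t)))\<^sup>2 \<le> n * ?E t" if "a \<in> A" for a t
      proof -
        have "f (real a + t) - P (real a + t) = (\<Sum>l\<in>\<Lambda>. expo l (real a + t) * (H l t - p l t))"
          by (simp add: f_eq[OF that] P_def p_shift right_diff_distrib sum_subtractf)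
        also have "cmod \<dots> \<le> (\<Sum>l\<in>\<Lambda>. cmod (H l t - p l t))"
          by (rule sum_norm_le) (simp add: norm_mult)
        finally have "(cmod (f (real a + t) - P (real a + t)))\<^sup>2 \<le> (\<Sum>l\<in>\<Lambda>. cmod (H l t - p l t))\<^sup>2"
          by (intro power_mono) auto
        \<comment> \<open>Cauchy-Schwarz for a sum of \<open>n\<close> terms.\<close>
        also have "\<dots> \<le> n * ?E t"
          using sum_squared_le_sum_of_squares[of "\<lambda>l. cmod (H l t - p l t)" \<Lambda>]
          by (simp add: n_def mult.commute)
        finally show ?thesis .
      qed
      have int: "integrable unit_lebesgue (\<lambda>t. (cmod (f (real a + t) - P (real a + t)))\<^sup>2)"
        if "a \<in> A" for a
        using bound[OF that] order_trans[OF bound[OF that] abs_ge_self]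
        by (intro Bochner_Integration.integrable_bound[OF E_int]) auto
      have "(LINT x|?M. (cmod (f x - P x))\<^sup>2)
          = (\<Sum>a\<in>A. LINT t|unit_lebesgue. (cmod (f (real a + t) - P (real a + t)))\<^sup>2)"
        using int by (intro integral_cells) auto
      also have "\<dots> \<le> (\<Sum>a\<in>A. LINT t|unit_lebesgue. n * ?E t)"
        by (intro sum_mono integral_mono int E_int bound)
      also have "\<dots> = real (card A) * (n * (\<Sum>l\<in>\<Lambda>. LINT t|unit_lebesgue. (cmod (H l t - p l t))\<^sup>2))"
        using Hp_int by simp
      also have "\<dots> \<le> real (card A) * (n * (\<Sum>l\<in>\<Lambda>. \<eta>))"
        by (intro mult_left_mono sum_mono less_imp_le[OF p(2)]) (auto simp: n_def)
      also have "\<dots> = (real (card A) * n * n) * \<eta>" by (simp add: n_def)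
      also have "\<dots> < (real (card A) * n * n + 1) * \<eta>" using \<eta> by (simp add: distrib_right)
      also have "\<dots> = \<delta>" using pos by (simp add: \<eta>_def)
      finally show ?thesis using P by blast
    qed
    with f show "f \<in> approximable ?M ?S expo" by (auto simp: approximable_def)
  qed
qed

text \<open>A spectrum is determined by its part in \<open>[0,1)\<close>. When it contains 0, every
  other point of that part is a zero of the mask, so the part is a subset of a fixed finite
  set.\<close>

lemma finite_domain_spectra:
  "finite {\<Lambda>. spectrum_of_domain cells \<Lambda> \<and> 0 \<in> \<Lambda>}"
proof -
  obtain R where R: "finite R" "\<And>s. mask s = 0 \<Longrightarrow> expo s 1 \<in> R" using finite_mask_zeros by blast
  \<comment> \<open>The point 1 is added for the frequency 0, which is not a zero of the
    mask.\<close>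
  define Z where "Z = {s \<in> {0..<1}. expo s 1 \<in> insert 1 R}"
  have "finite Z" unfolding Z_def using R(1) by (intro finite_expo_1_fibres) simp
  moreover have "{\<Lambda>. spectrum_of_domain cells \<Lambda> \<and> 0 \<in> \<Lambda>} \<subseteq> minkowski_sum \<int> ` Pow Z"
  proof safe
    fix \<Lambda> assume \<Lambda>: "spectrum_of_domain cells \<Lambda>" "0 \<in> \<Lambda>"
    note sub = finite_set_spectrum_of_domain_spectrum[OF \<Lambda>(1)]
    have "\<Lambda> \<inter> {0..<1} \<subseteq> Z"
    proof
      fix l assume l: "l \<in> \<Lambda> \<inter> {0..<1}"
      then show "l \<in> Z" using sub(3)[of l 0] \<Lambda>(2) R(2)[of l] by (cases "l = 0") (auto simp: Z_def)
    qed
    then show "\<Lambda> \<in> minkowski_sum \<int> ` Pow Z" using sub(1) by blast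
  qed
  ultimately show ?thesis by (meson finite_Pow_iff finite_imageI finite_subset)
qed

end

theorem theorem3p25:
  fixes A :: "nat set" and \<Omega> :: "real set"
  assumes "finite A" and "0 \<in> A"
    and "\<Omega> = minkowski_sum (real ` A) {0..1}"
  shows "(spectral_domain \<Omega> \<longleftrightarrow> spectral_finite_set (real ` A)) \<and>
    (spectral_domain \<Omega> \<longrightarrow>
       (\<forall>\<Lambda>. spectrum_of_domain \<Omega> \<Lambda> \<longrightarrow>
          (\<exists>\<Lambda>\<^sub>A. spectrum_of_finite_set (real ` A) \<Lambda>\<^sub>A \<and> \<Lambda> = minkowski_sum \<int> \<Lambda>\<^sub>A)) \<and>
       finite {\<Lambda>. spectrum_of_domain \<Omega> \<Lambda> \<and> 0 \<in> \<Lambda>})"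
proof -
  have A: "finite A" "A \<noteq> {}" using assms by auto
  have eq: "\<Omega> = cells A" using assms(3) by (simp add: cells_def[OF A])
  show ?thesis
    unfolding spectral_domain_def spectral_finite_set_def eq
    using finite_set_spectrum_of_domain_spectrum(1,2)[OF A]
      domain_spectrum_of_finite_set_spectrum[OF A] finite_domain_spectra[OF A]
    by blast
qed

end
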